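(* Let $(X_t)$ be a reversible irreducible continuous-time Markov chain on a finite state space $\Omega$ with generator $G$. Let $(\tilde X_t)$ be a chain with generator $\tilde G$ obtained by multiplying, for all $x\in\Omega$, the $x$th row of $G$ by some $r_x\in(1/M,M)$ (for some $M\ge 1$). Then for some absolute constant $C$ the corresponding $L_2$ mixing times $\tau_2,\tilde\tau_2$ and relative-entropy mixing times $\tau_{\mathrm{Ent}},\tilde\tau_{\mathrm{Ent}}$ of $(X_t)$ and $(\tilde X_t)$, respectively, satisfy $$\tilde\tau_2/(CM\log M)\le\tau_2\le (CM\log M)\,\tilde\tau_2,$$ $$\tilde\tau_{\mathrm{Ent}}/(CM\log M)\le\tau_{\mathrm{Ent}}\le (CM\log M)\,\tilde\tau_{\mathrm{Ent}}.$$
   Context: A continuous-time chain with generator $G$ on the finite set $\Omega$ has transition semigroup $e^{tG}$, and $\mathrm P_x^t=e^{tG}(x,\cdot)$ is its law at time $t$ started at $x$. Let $\pi$ be its stationary distribution; reversible means $\pi(x)G(x,y)=\pi(y)G(y,x)$ for all $x,y$. For a signed measure $\sigma$, $\|\sigma\|_{2,\pi}=\big(\sum_x\pi(x)(\sigma(x)/\pi(x))^2\big)^{1/2}$. The $L_2$ mixing time is $\tau_2=\max_x\min\{t\ge0:\|\mathrm P_x^t-\pi\|_{2,\pi}\le1/2\}$. The relative-entropy mixing time is $\tau_{\mathrm{Ent}}=\max_x\inf\{t\ge0:D(\mathrm P_x^t\|\pi)\le1/2\}$, where $D(\mu\|\pi)=\sum_x\mu(x)\log(\mu(x)/\pi(x))$,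 with the convention $0\log 0=0$. The quantities $\tilde\tau_2,\tilde\tau_{\mathrm{Ent}}$ are defined in the same way for the chain with generator $\tilde G$ and its own stationary distribution $\tilde\pi$. An absolute constant is one that does not depend on the chain, on $M$, or on the $r_x$.
   Formalization: The factor $\log M$ is replaced by $\log\max(2,M)$, since with $r_x=1$ and $M\to1^+$ the stated bounds fail; for $M\ge2$ they are unchanged. Finite state spaces are taken, up to relabelling, as finite sets of natural numbers. *)

theory Defs
  imports "HOL-Analysis.Analysis"
begin

text \<open>A chain is given by a finite carrier set of states and a rate matrix, a function of which
  only the values on the carrier matter.\<close>

definition generator :: "'a set \<Rightarrow> ('a \<Rightarrow> 'a \<Rightarrow> real) \<Rightarrow> bool" where
  "generator \<Omega> G \<longleftrightarrow> finite \<Omega> \<and> \<Omega> \<noteq> {}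
     \<and> (\<forall>x\<in>\<Omega>. \<forall>y\<in>\<Omega>. x \<noteq> y \<longrightarrow> 0 \<le> G x y)
     \<and> (\<forall>x\<in>\<Omega>. (\<Sum>y\<in>\<Omega>. G x y) = 0)"

definition irreducible_chain :: "'a set \<Rightarrow> ('a \<Rightarrow> 'a \<Rightarrow> real) \<Rightarrow> bool" where
  "irreducible_chain \<Omega> G \<longleftrightarrow>
     (\<forall>x\<in>\<Omega>. \<forall>y\<in>\<Omega>. (x, y) \<in> {(u, v). u \<in> \<Omega> \<and> v \<in> \<Omega> \<and> 0 < G u v}\<^sup>*)"

fun gen_power :: "'a set \<Rightarrow> ('a \<Rightarrow> 'a \<Rightarrow> real) \<Rightarrow> nat \<Rightarrow> 'a \<Rightarrow> 'a \<Rightarrow> real" where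
  "gen_power \<Omega> G 0 x y = (if x = y then 1 else 0)"
| "gen_power \<Omega> G (Suc n) x y = (\<Sum>z\<in>\<Omega>. G x z * gen_power \<Omega> G n z y)"

text \<open>The entries of the matrix exponential \<open>e\<^sup>t\<^sup>G\<close>. As the size of the matrix varies inside
  the theorem, it is given by its entrywise power series.\<close>

definition transition :: "'a set \<Rightarrow> ('a \<Rightarrow> 'a \<Rightarrow> real) \<Rightarrow> real \<Rightarrow> 'a \<Rightarrow> 'a \<Rightarrow> real" where
  "transition \<Omega> G t x y = (\<Sum>n. t ^ n / fact n * gen_power \<Omega> G n x y)"

definition stationary_distribution ::
    "'a set \<Rightarrow> ('a \<Rightarrow> 'a \<Rightarrow> real) \<Rightarrow> ('a \<Rightarrow> real) \<Rightarrow> bool" where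
  "stationary_distribution \<Omega> G \<pi> \<longleftrightarrow>
     (\<forall>x\<in>\<Omega>. 0 \<le> \<pi> x) \<and> (\<Sum>x\<in>\<Omega>. \<pi> x) = 1
     \<and> (\<forall>t\<ge>0. \<forall>y\<in>\<Omega>. (\<Sum>x\<in>\<Omega>. \<pi> x * transition \<Omega> G t x y) = \<pi> y)"

definition reversible_chain ::
    "'a set \<Rightarrow> ('a \<Rightarrow> 'a \<Rightarrow> real) \<Rightarrow> ('a \<Rightarrow> real) \<Rightarrow> bool" where
  "reversible_chain \<Omega> G \<pi> \<longleftrightarrow> (\<forall>x\<in>\<Omega>. \<forall>y\<in>\<Omega>. \<pi> x * G x y = \<pi> y * G y x)"

definition l2_norm :: "'a set \<Rightarrow> ('a \<Rightarrow> real) \<Rightarrow> ('a \<Rightarrow> real) \<Rightarrow> real" where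
  "l2_norm \<Omega> \<pi> \<sigma> = sqrt (\<Sum>x\<in>\<Omega>. \<pi> x * (\<sigma> x / \<pi> x)\<^sup>2)"

text \<open>The convention \<open>0 log 0 = 0\<close> holds here because of the factor \<open>\<mu> x\<close>.\<close>

definition rel_entropy :: "'a set \<Rightarrow> ('a \<Rightarrow> real) \<Rightarrow> ('a \<Rightarrow> real) \<Rightarrow> real" where
  "rel_entropy \<Omega> \<mu> \<pi> = (\<Sum>x\<in>\<Omega>. \<mu> x * ln (\<mu> x / \<pi> x))"

text \<open>In the mixing times, \<open>\<pi>\<close> is meant to be the stationary distribution of the chain.
  \<open>LEAST\<close> is the minimum; it exists for irreducible chains, by continuity in \<open>t\<close> and
  convergence to \<open>\<pi>\<close>.\<close>

definition tau_2 :: "'a set \<Rightarrow> ('a \<Rightarrow> 'a \<Rightarrow> real) \<Rightarrow> ('a \<Rightarrow> real) \<Rightarrow> real" where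
  "tau_2 \<Omega> G \<pi> =
     (MAX x\<in>\<Omega>. LEAST t. 0 \<le> t \<and> l2_norm \<Omega> \<pi> (\<lambda>y. transition \<Omega> G t x y - \<pi> y) \<le> 1 / 2)"

definition tau_Ent :: "'a set \<Rightarrow> ('a \<Rightarrow> 'a \<Rightarrow> real) \<Rightarrow> ('a \<Rightarrow> real) \<Rightarrow> real" where
  "tau_Ent \<Omega> G \<pi> =
     (MAX x\<in>\<Omega>. Inf {t. 0 \<le> t \<and> rel_entropy \<Omega> (transition \<Omega> G t x) \<pi> \<le> 1 / 2})"

text \<open>In bounds with the factor \<open>M log M\<close>, the logarithm is taken at \<open>max 2 M\<close>. This changes
  nothing for \<open>M \<ge> 2\<close>. For \<open>M\<close> close to \<open>1\<close> the factor has to be kept away from \<open>0\<close>: if all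
  rows are multiplied by \<open>1\<close>, the two chains coincide and have positive mixing times as soon
  as there are two states, so \<open>1 \<le> C * M * ln M\<close> would follow for every \<open>M > 1\<close>.

  State spaces are finite sets of natural numbers. Up to relabelling these are all finite
  state spaces, and with a fixed infinite type of states a constant chosen before the state
  space does not depend on its size (it could if the type were a finite type variable).\<close>

end

theory Submission
  imports Defs
begin

text \<open>Let \<open>P\<close> and \<open>P'\<close> be the semigroups of \<open>G\<close> and \<open>G'\<close>. Running the second chain for time \<open>M t\<close> means
  stopping the first one at a random time that is at least \<open>t\<close>. Hence \<open>P' (M t) f \<le> P t F\<close> whenever \<open>F\<close>
  dominates \<open>P' a f\<close> for all \<open>a \<in> [0, M t]\<close>; analytically, this is a minimum principle in two time
  variables. If \<open>f\<close> is itself of the form \<open>P' (M t + u) g\<close> with \<open>g\<close> of mean \<open>0\<close>, a simple maximal inequality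
  gives such an \<open>F\<close> whose \<open>L\<^sub>2\<close> norm is at most \<open>\<surd>3\<close> times that of \<open>P' u g\<close>, so at most
  \<open>\<surd>3 exp (- u / K')\<close> times that of \<open>g\<close>, where \<open>K'\<close> is a relaxation time of the second chain. The
  Dirichlet forms of the two chains are proportional, so \<open>K'\<close> is at most \<open>M\<close> times a relaxation time
  of the first chain, which in turn is bounded by its mixing times. Passing from \<open>\<pi>'\<close> to \<open>\<pi>\<close> costs a
  power of \<open>M\<close>, which is absorbed by taking \<open>u\<close> of order \<open>K' log M\<close>.

  If \<open>t\<close> is the \<open>L\<^sub>2\<close> mixing time, the Cauchy--Schwarz inequality bounds \<open>P t F\<close> by the \<open>L\<^sub>2\<close> norm of \<open>F\<close>.
  If \<open>t\<close> is the entropy mixing time, Gibbs' variational inequality bounds it by an exponential moment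
  of \<open>F\<close>; the test function is then \<open>f = ln (1 + p)\<close> with \<open>p\<close> the density at the final time, as the
  relative entropy is at most \<open>2 (P' f - \<pi>' f)\<close>.\<close>

section \<open>The semigroup of a finite generator\<close>

lemma generatorD:
  assumes "generator \<Omega> G"
  shows "finite \<Omega>" "\<Omega> \<noteq> {}" "\<And>x y. x \<in> \<Omega> \<Longrightarrow> y \<in> \<Omega> \<Longrightarrow> x \<noteq> y \<Longrightarrow> 0 \<le> G x y"
    "\<And>x. x \<in> \<Omega> \<Longrightarrow> (\<Sum>y\<in>\<Omega>. G x y) = 0"
  using assms by (auto simp: generator_def)

text \<open>As row sums vanish, \<open>v x\<close> may be subtracted from \<open>v\<close>; the
  diagonal entry, the only one that may be negative, then meets the value 0.\<close>

lemma generator_nonneg_at_min: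
  assumes "generator \<Omega> G" "x \<in> \<Omega>" "\<And>y. y \<in> \<Omega> \<Longrightarrow> v x \<le> v y"
  shows "0 \<le> (\<Sum>y\<in>\<Omega>. G x y * v y)"
proof -
  have "(\<Sum>y\<in>\<Omega>. G x y * v y) = (\<Sum>y\<in>\<Omega>. G x y * (v y - v x))"
    using generatorD(4)[OF assms(1,2)]
    by (simp add: right_diff_distrib sum_subtractf flip: sum_distrib_right)
  also have "\<dots> \<ge> 0"
  proof (rule sum_nonneg)
    fix y assume "y \<in> \<Omega>"
    then show "0 \<le> G x y * (v y - v x)"
      using assms generatorD(3)[OF assms(1,2), of y] by (cases "y = x") auto
  qed
  finally show ?thesis .
qed

text \<open>A minimum of \<open>H + \<epsilon> s\<close> over the triangle cannot lie at \<open>s > 0\<close>: going back along the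
  characteristic \<open>(s - h, a - h \<rho> x)\<close>, which stays in the triangle, would decrease it.\<close>

lemma minimum_principle:
  fixes H :: "real \<Rightarrow> real \<Rightarrow> 'a \<Rightarrow> real"
  assumes gen: "generator \<Omega> G" and M: "0 < M"
    and \<rho>: "\<And>x. x \<in> \<Omega> \<Longrightarrow> 0 \<le> \<rho> x \<and> \<rho> x \<le> M"
    and cont: "\<And>x. x \<in> \<Omega> \<Longrightarrow> continuous_on UNIV (\<lambda>z. H (fst z) (snd z) x)"
    and deriv: "\<And>x s a. x \<in> \<Omega> \<Longrightarrow> 0 < s \<Longrightarrow>
      ((\<lambda>h. H (s - h) (a - h * \<rho> x) x) has_real_derivative - (\<Sum>y\<in>\<Omega>. G x y * H s a y)) (at 0)"
    and init: "\<And>x a. x \<in> \<Omega> \<Longrightarrow> 0 \<le> a \<Longrightarrow> a \<le> T \<Longrightarrow> 0 \<le> H 0 a x"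
    and in_triangle: "0 \<le> s" "M * s \<le> a" "a \<le> T" and x: "x \<in> \<Omega>"
  shows "0 \<le> H s a x"
proof -
  define D where "D = {z::real \<times> real. 0 \<le> fst z \<and> M * fst z \<le> snd z \<and> snd z \<le> T}"
  have "D \<subseteq> cbox (0,0) (T / M, T)"
  proof
    fix z assume z: "z \<in> D"
    then have 1: "0 \<le> fst z" "M * fst z \<le> snd z" "snd z \<le> T"
      by (auto simp: D_def)
    moreover have "0 \<le> M * fst z" using 1 M by simp
    moreover have "fst z \<le> T / M" using 1 M by (simp add: pos_le_divide_eq mult.commute)
    ultimately have "fst z \<in> {0..T/M}" "snd z \<in> {0..T}" by simp_all
    then show "z \<in> cbox (0,0) (T / M, T)"
      by (cases z) (simp add: cbox_Pair_eq)
  qed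
  then have "bounded D" using bounded_cbox bounded_subset by blast
  moreover have "closed D"
    unfolding D_def by (intro closed_Collect_conj closed_Collect_le continuous_intros)
  ultimately have comp: "compact D" using compact_eq_bounded_closed by blast
  have ne: "D \<noteq> {}" using in_triangle by (auto simp: D_def)
  have fin: "finite \<Omega>" using gen generatorD by blast
  \<comment> \<open>At a minimum the generator term is only known to be nonnegative; the term
    \<open>\<epsilon> * s\<close> makes the derivative along the characteristic strictly
    negative.\<close>
  have key: "0 \<le> H s a x + \<epsilon> * s" if \<epsilon>: "\<epsilon> > 0" for \<epsilon>
  proof -
    define V where "V = (\<lambda>z x. H (fst z) (snd z) x + \<epsilon> * fst z)"
    have "\<forall>x\<in>\<Omega>. \<exists>z\<in>D. \<forall>w\<in>D. V z x \<le> V w x"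
    proof
      fix x assume "x \<in> \<Omega>"
      then have "continuous_on D (\<lambda>z. V z x)"
        unfolding V_def
        by (intro continuous_intros continuous_on_subset[OF cont]) auto
      then show "\<exists>z\<in>D. \<forall>w\<in>D. V z x \<le> V w x"
        using continuous_attains_inf[OF comp ne] by blast
    qed
    then obtain Z where Z: "\<And>x. x \<in> \<Omega> \<Longrightarrow> Z x \<in> D" "\<And>x w. x \<in> \<Omega> \<Longrightarrow> w \<in> D \<Longrightarrow> V (Z x) x \<le> V w x"
      by metis
    obtain x0 where x0: "x0 \<in> \<Omega>" "\<And>x. x \<in> \<Omega> \<Longrightarrow> V (Z x0) x0 \<le> V (Z x) x"
      using ex_is_arg_min_if_finite[OF fin generatorD(2)[OF gen], of "\<lambda>x. V (Z x) x"]
      by (auto simp: is_arg_min_linorder)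
    obtain s0 a0 where sa: "Z x0 = (s0, a0)" by fastforce
    have D0: "0 \<le> s0" "M * s0 \<le> a0" "a0 \<le> T" using Z(1)[OF x0(1)] sa by (auto simp: D_def)
    have minV: "V (s0, a0) x0 \<le> V w y" if "w \<in> D" "y \<in> \<Omega>" for w y
      using x0(2)[of y] Z(2)[of y w] that sa by simp
    have "s0 = 0"
    proof (rule ccontr)
      assume "s0 \<noteq> 0"
      then have s0: "0 < s0" using D0 by simp
      have "0 \<le> (\<Sum>y\<in>\<Omega>. G x0 y * H s0 a0 y)"
      proof (rule generator_nonneg_at_min[OF gen x0(1)])
        fix y assume "y \<in> \<Omega>"
        then show "H s0 a0 x0 \<le> H s0 a0 y"
          using minV[of "(s0, a0)" y] D0 by (simp add: V_def D_def)
      qed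
      moreover have "((\<lambda>h. V (s0 - h, a0 - h * \<rho> x0) x0) has_real_derivative
           - (\<Sum>y\<in>\<Omega>. G x0 y * H s0 a0 y) - \<epsilon>) (at 0)"
        unfolding V_def fst_conv snd_conv
        by (rule derivative_eq_intros deriv[OF x0(1) s0] refl | simp)+
      ultimately obtain d where d: "d > 0"
        "\<And>h. 0 < h \<Longrightarrow> h < d \<Longrightarrow> V (s0 - h, a0 - h * \<rho> x0) x0 < V (s0, a0) x0"
        using DERIV_neg_dec_right[of "\<lambda>h. V (s0 - h, a0 - h * \<rho> x0) x0" _ 0] \<epsilon> by force
      \<comment> \<open>\<open>h \<le> s0\<close> keeps the first coordinate nonnegative, and
        \<open>\<rho> x0 \<le> M\<close> preserves \<open>M * s \<le> a\<close>.\<close>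
      define h where "h = min (d / 2) s0"
      have h: "0 < h" "h < d" "h \<le> s0" using d(1) s0 by (auto simp: h_def)
      have "h * \<rho> x0 \<le> M * h" "0 \<le> h * \<rho> x0"
        using h \<rho>[OF x0(1)] by (auto simp: mult.commute[of M])
      then have "M * (s0 - h) \<le> a0 - h * \<rho> x0" "a0 - h * \<rho> x0 \<le> T"
        using D0 unfolding right_diff_distrib by linarith+
      then have "(s0 - h, a0 - h * \<rho> x0) \<in> D" using h by (simp add: D_def)
      then show False using minV[of _ x0] d(2)[of h] h x0(1) by fastforce
    qed
    then have "0 \<le> V (s0, a0) x0"
      using init[OF x0(1), of a0] D0 by (simp add: V_def)
    also have "\<dots> \<le> V (s, a) x" using minV in_triangle x by (simp add: D_def)
    finally show ?thesis by (simp add: V_def)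
  qed
  show ?thesis
  proof (rule ccontr)
    assume neg: "\<not> 0 \<le> H s a x"
    then have pos: "0 < - H s a x / (2 * (s + 1))"
      using in_triangle by (intro divide_pos_pos) auto
    have "s / (2 * (s + 1)) < 1" using in_triangle by simp
    then have "- H s a x * (s / (2 * (s + 1))) < - H s a x * 1"
      using neg by (intro mult_strict_left_mono) auto
    then show False using key[OF pos] by simp
  qed
qed

section \<open>The semigroup as operators: backward equation, positivity, Jensen's
  inequality\<close>

locale chain =
  fixes \<Omega> :: "'a set" and G :: "'a \<Rightarrow> 'a \<Rightarrow> real"
  assumes gen: "generator \<Omega> G"
begin

lemma fin [simp, intro]: "finite \<Omega>" and nonempty: "\<Omega> \<noteq> {}"
  using generatorD[OF gen] by auto

definition L :: "('a \<Rightarrow> real) \<Rightarrow> 'a \<Rightarrow> real" where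
  "L f x = (\<Sum>y\<in>\<Omega>. G x y * f y)"

definition P :: "real \<Rightarrow> ('a \<Rightarrow> real) \<Rightarrow> 'a \<Rightarrow> real" where
  "P t f x = (\<Sum>y\<in>\<Omega>. transition \<Omega> G t x y * f y)"

text \<open>A crude bound suffices, as it only has to make the exponential series converge.\<close>

lemma abs_gen_power_le:
  assumes "x \<in> \<Omega>" "y \<in> \<Omega>"
  shows "\<bar>gen_power \<Omega> G n x y\<bar> \<le> (\<Sum>u\<in>\<Omega>. \<Sum>v\<in>\<Omega>. \<bar>G u v\<bar>) ^ n"
  using assms
proof (induction n arbitrary: x)
  case (Suc n)
  let ?B = "\<Sum>u\<in>\<Omega>. \<Sum>v\<in>\<Omega>. \<bar>G u v\<bar>"
  have B: "0 \<le> ?B" by (intro sum_nonneg) auto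
  have "\<bar>gen_power \<Omega> G (Suc n) x y\<bar> \<le> (\<Sum>z\<in>\<Omega>. \<bar>G x z\<bar> * \<bar>gen_power \<Omega> G n z y\<bar>)"
    using sum_abs[of "\<lambda>z. G x z * gen_power \<Omega> G n z y" \<Omega>] by (simp add: abs_mult)
  also have "\<dots> \<le> (\<Sum>z\<in>\<Omega>. \<bar>G x z\<bar> * ?B ^ n)"
    using Suc by (intro sum_mono mult_left_mono) auto
  also have "\<dots> = (\<Sum>z\<in>\<Omega>. \<bar>G x z\<bar>) * ?B ^ n" by (simp add: sum_distrib_right)
  also have "(\<Sum>z\<in>\<Omega>. \<bar>G x z\<bar>) \<le> ?B"
    using Suc.prems by (intro member_le_sum[of x \<Omega> "\<lambda>u. \<Sum>v\<in>\<Omega>. \<bar>G u v\<bar>"]) (auto intro: sum_nonneg)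
  finally show ?case using B by (simp add: mult_right_mono)
qed simp

lemma summable_transition:
  assumes "x \<in> \<Omega>" "y \<in> \<Omega>"
  shows "summable (\<lambda>n. gen_power \<Omega> G n x y / fact n * t ^ n)"
proof (rule summable_comparison_test)
  let ?B = "\<Sum>u\<in>\<Omega>. \<Sum>v\<in>\<Omega>. \<bar>G u v\<bar>"
  show "summable (\<lambda>n. (?B * \<bar>t\<bar>) ^ n /\<^sub>R fact n)" by (rule summable_exp_generic)
  have "norm (gen_power \<Omega> G n x y / fact n * t ^ n) \<le> (?B * \<bar>t\<bar>) ^ n /\<^sub>R fact n" for n
    using mult_right_mono[OF abs_gen_power_le[OF assms, of n], of "\<bar>t\<bar> ^ n"]
    by (simp add: abs_mult power_abs power_mult_distrib divide_simps)
  then show "\<exists>N. \<forall>n\<ge>N. norm (gen_power \<Omega> G n x y / fact n * t ^ n) \<le> (?B * \<bar>t\<bar>) ^ n /\<^sub>R fact n"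
    by blast
qed

text \<open>Kolmogorov's backward equation: differentiating the power series shifts its
  coefficients, and the recursion of \<open>gen_power\<close> splits off a factor \<open>G\<close>
  on the left.\<close>

lemma transition_deriv:
  assumes "x \<in> \<Omega>" "y \<in> \<Omega>"
  shows "((\<lambda>t. transition \<Omega> G t x y) has_real_derivative
     (\<Sum>z\<in>\<Omega>. G x z * transition \<Omega> G t z y)) (at t)"
proof -
  let ?c = "\<lambda>x n. gen_power \<Omega> G n x y / fact n"
  have tr: "transition \<Omega> G t x y = (\<Sum>n. ?c x n * t ^ n)" for t x
    unfolding transition_def by (simp add: mult.commute)
  have df: "diffs (?c x) n = (\<Sum>z\<in>\<Omega>. G x z * ?c z n)" for n
    by (simp add: diffs_def sum_distrib_left sum_divide_distrib del: of_nat_Suc)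
  have "(\<Sum>n. diffs (?c x) n * t ^ n) = (\<Sum>n. \<Sum>z\<in>\<Omega>. G x z * (?c z n * t ^ n))"
    by (simp add: df sum_distrib_left sum_distrib_right algebra_simps)
  also have "\<dots> = (\<Sum>z\<in>\<Omega>. \<Sum>n. G x z * (?c z n * t ^ n))"
    by (intro suminf_sum summable_mult summable_transition assms)
  also have "\<dots> = (\<Sum>z\<in>\<Omega>. G x z * transition \<Omega> G t z y)"
    unfolding tr by (intro sum.cong refl suminf_mult summable_transition assms)
  finally show ?thesis
    unfolding tr using termdiffs_strong_converges_everywhere[of "?c x" t] summable_transition[OF assms]
    by simp
qed

lemma P_deriv:
  assumes "x \<in> \<Omega>"
  shows "((\<lambda>t. P t f x) has_real_derivative L (P t f) x) (at t)"
proof -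
  have "((\<lambda>t. P t f x) has_real_derivative
      (\<Sum>y\<in>\<Omega>. (\<Sum>z\<in>\<Omega>. G x z * transition \<Omega> G t z y) * f y)) (at t)"
    unfolding P_def using assms
    by (intro DERIV_sum DERIV_cmult_right transition_deriv) auto
  also have "(\<Sum>y\<in>\<Omega>. (\<Sum>z\<in>\<Omega>. G x z * transition \<Omega> G t z y) * f y) = L (P t f) x"
    unfolding L_def P_def
    by (simp add: sum_distrib_left sum_distrib_right mult.assoc) (rule sum.swap)
  finally show ?thesis .
qed

lemma P_deriv_chain:
  assumes "x \<in> \<Omega>" "(g has_real_derivative d) (at s)"
  shows "((\<lambda>s. P (g s) f x) has_real_derivative L (P (g s) f) x * d) (at s)"
  by (rule DERIV_chain2[OF P_deriv[OF assms(1)] assms(2)])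

lemma P_0 [simp]: "x \<in> \<Omega> \<Longrightarrow> P 0 f x = f x"
proof -
  assume x: "x \<in> \<Omega>"
  have "transition \<Omega> G 0 x y = (if x = y then 1 else 0)" for y
    unfolding transition_def
    using powser_zero[of "\<lambda>n. gen_power \<Omega> G n x y / fact n"] by (simp add: mult.commute)
  then show ?thesis unfolding P_def using x by (simp add: sum.delta if_distrib[of "\<lambda>c. c * _"] cong: if_cong)
qed

lemma P_cong: "(\<And>y. y \<in> \<Omega> \<Longrightarrow> f y = g y) \<Longrightarrow> P t f x = P t g x"
  and L_cong: "(\<And>y. y \<in> \<Omega> \<Longrightarrow> f y = g y) \<Longrightarrow> L f x = L g x"
  unfolding P_def L_def by (simp_all cong: sum.cong)

lemma P_add: "P t (\<lambda>y. f y + g y) x = P t f x + P t g x"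
  and P_diff: "P t (\<lambda>y. f y - g y) x = P t f x - P t g x"
  and P_cmult: "P t (\<lambda>y. c * f y) x = c * P t f x"
  and L_diff: "L (\<lambda>y. f y - g y) x = L f x - L g x"
  by (simp_all add: P_def L_def algebra_simps sum.distrib sum_subtractf sum_distrib_left)

lemma P_continuous: "x \<in> \<Omega> \<Longrightarrow> continuous_on A (\<lambda>t. P t f x)"
  using P_deriv by (meson DERIV_isCont continuous_at_imp_continuous_on)

text \<open>The case of the minimum principle without dependence on the second time variable. It
  yields positivity of the semigroup and uniqueness for the backward equation.\<close>

lemma ode_nonneg:
  assumes deriv: "\<And>x t. x \<in> \<Omega> \<Longrightarrow> ((\<lambda>t. u t x) has_real_derivative L (u t) x) (at t)"
    and init: "\<And>x. x \<in> \<Omega> \<Longrightarrow> 0 \<le> u 0 x"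
    and "0 \<le> t" "x \<in> \<Omega>"
  shows "0 \<le> u t x"
proof (rule minimum_principle[OF gen, where M = 1 and \<rho> = "\<lambda>_. 0" and H = "\<lambda>s a x. u s x" and T = t and a = t])
  fix x assume "x \<in> \<Omega>"
  then have "continuous_on UNIV (\<lambda>s. u s x)"
    using deriv by (meson DERIV_isCont continuous_at_imp_continuous_on)
  then show "continuous_on UNIV (\<lambda>z::real \<times> real. u (fst z) x)"
    by (rule continuous_on_compose2) (auto intro: continuous_intros)
next
  fix x s and a :: real assume x: "x \<in> \<Omega>"
  have "((\<lambda>h. u (s - h) x) has_real_derivative L (u s) x * (- 1)) (at 0)"
    by (rule DERIV_chain2[of "\<lambda>t. u t x"]) (use deriv[OF x] in \<open>auto intro!: derivative_eq_intros\<close>)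
  then show "((\<lambda>h. u (s - h) x) has_real_derivative - (\<Sum>y\<in>\<Omega>. G x y * u s y)) (at 0)"
    by (simp add: L_def)
qed (use assms in auto)

lemma ode_unique:
  assumes "\<And>x t. x \<in> \<Omega> \<Longrightarrow> ((\<lambda>t. u t x) has_real_derivative L (u t) x) (at t)"
    and "0 \<le> t" "x \<in> \<Omega>"
  shows "u t x = P t (u 0) x"
proof -
  have "0 \<le> u t x - P t (u 0) x"
    using assms(2,3)
    by (rule ode_nonneg[of "\<lambda>t x. u t x - P t (u 0) x", rotated 2])
       (auto simp: L_diff intro!: derivative_intros assms(1) P_deriv)
  moreover have "0 \<le> P t (u 0) x - u t x"
    using assms(2,3)
    by (rule ode_nonneg[of "\<lambda>t x. P t (u 0) x - u t x", rotated 2])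
       (auto simp: L_diff intro!: derivative_intros assms(1) P_deriv)
  ultimately show ?thesis by simp
qed

lemma P_nonneg: "0 \<le> t \<Longrightarrow> x \<in> \<Omega> \<Longrightarrow> (\<And>y. y \<in> \<Omega> \<Longrightarrow> 0 \<le> f y) \<Longrightarrow> 0 \<le> P t f x"
  by (rule ode_nonneg[of "\<lambda>t. P t f"]) (auto intro: P_deriv)

lemma P_mono:
  "0 \<le> t \<Longrightarrow> x \<in> \<Omega> \<Longrightarrow> (\<And>y. y \<in> \<Omega> \<Longrightarrow> f y \<le> g y) \<Longrightarrow> P t f x \<le> P t g x"
  using P_nonneg[of t x "\<lambda>y. g y - f y"] by (simp add: P_diff)

lemma P_const [simp]: "0 \<le> t \<Longrightarrow> x \<in> \<Omega> \<Longrightarrow> P t (\<lambda>_. c) x = c"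
  using ode_unique[of "\<lambda>_ _. c" t x] generatorD(4)[OF gen]
  by (simp add: L_def flip: sum_distrib_right)

lemma P_semigroup: "0 \<le> s \<Longrightarrow> 0 \<le> t \<Longrightarrow> x \<in> \<Omega> \<Longrightarrow> P (s + t) f x = P s (P t f) x"
proof -
  assume "0 \<le> s" "0 \<le> t" "x \<in> \<Omega>"
  have "((\<lambda>s. P (s + t) f x) has_real_derivative L (P (s + t) f) x) (at s)" if "x \<in> \<Omega>" for x s
    by (rule DERIV_cong[OF P_deriv_chain[OF that, where d = 1]])
       (auto intro!: derivative_eq_intros)
  from ode_unique[of "\<lambda>s. P (s + t) f", OF this \<open>0 \<le> s\<close> \<open>x \<in> \<Omega>\<close>] show ?thesis by simp
qed

lemma P_delta: "y \<in> \<Omega> \<Longrightarrow> P t (\<lambda>z. if z = y then c else 0) x = transition \<Omega> G t x y * c"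
  by (simp add: P_def if_distrib cong: if_cong)

lemma transition_nonneg: "0 \<le> t \<Longrightarrow> x \<in> \<Omega> \<Longrightarrow> y \<in> \<Omega> \<Longrightarrow> 0 \<le> transition \<Omega> G t x y"
  using P_nonneg[of t x "\<lambda>z. if z = y then 1 else 0"] by (simp add: P_delta)

lemma transition_sum: "0 \<le> t \<Longrightarrow> x \<in> \<Omega> \<Longrightarrow> (\<Sum>y\<in>\<Omega>. transition \<Omega> G t x y) = 1"
  using P_const[of t x 1] by (simp add: P_def)

text \<open>Jensen's inequality: \<open>exp\<close> lies above its tangent at
  \<open>P t f x\<close>, and \<open>P t\<close> preserves order and constants.\<close>

lemma exp_P_le: assumes "0 \<le> t" "x \<in> \<Omega>" shows "exp (P t f x) \<le> P t (\<lambda>y. exp (f y)) x"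
proof -
  let ?m = "P t f x"
  have "exp ?m = P t (\<lambda>y. exp ?m + exp ?m * (f y - ?m)) x"
    unfolding P_add P_cmult P_diff using assms by simp
  also have "\<dots> \<le> P t (\<lambda>y. exp (f y)) x"
  proof (rule P_mono[OF assms])
    fix y
    have "exp ?m * (1 + (f y - ?m)) \<le> exp ?m * exp (f y - ?m)"
      by (intro mult_left_mono exp_ge_add_one_self) auto
    then show "exp ?m + exp ?m * (f y - ?m) \<le> exp (f y)"
      by (simp add: exp_diff algebra_simps)
  qed
  finally show ?thesis .
qed

end

text \<open>The chain with generator \<open>G'\<close> at time \<open>T\<close> is the chain with generator \<open>G\<close> at a stopping time
  that is at least \<open>s\<close>; at time \<open>s\<close>, the former chain still has some time \<open>a \<in> [0, T]\<close> to run.\<close>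

lemma time_change_le:
  assumes "generator \<Omega> G" "generator \<Omega> G'"
    and r: "\<And>x. x \<in> \<Omega> \<Longrightarrow> 0 < r x \<and> 1 / r x \<le> M"
    and G': "\<And>x y. x \<in> \<Omega> \<Longrightarrow> y \<in> \<Omega> \<Longrightarrow> G' x y = r x * G x y"
    and F: "\<And>x a. x \<in> \<Omega> \<Longrightarrow> 0 \<le> a \<Longrightarrow> a \<le> T \<Longrightarrow> chain.P \<Omega> G' a f x \<le> F x"
    and "0 < M" "0 \<le> s" "M * s \<le> T" "x \<in> \<Omega>"
  shows "chain.P \<Omega> G' T f x \<le> chain.P \<Omega> G s F x"
proof -
  interpret A: chain \<Omega> G by (unfold_locales) fact
  interpret B: chain \<Omega> G' by (unfold_locales) fact
  have "0 \<le> A.P s F x - B.P T f x"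
  proof (rule minimum_principle[OF assms(1) \<open>0 < M\<close>, where \<rho> = "\<lambda>x. 1 / r x" and
        H = "\<lambda>s a x. A.P s F x - B.P a f x" and T = T and a = T])
    fix x assume x: "x \<in> \<Omega>"
    show "continuous_on UNIV (\<lambda>z. A.P (fst z) F x - B.P (snd z) f x)"
      by (intro continuous_intros continuous_on_compose2[OF A.P_continuous[OF x, of UNIV]]
          continuous_on_compose2[OF B.P_continuous[OF x, of UNIV]]) auto
    fix s a :: real
    \<comment> \<open>At \<open>x\<close> the second clock runs at speed \<open>1 / r x\<close>,
      which cancels the factor \<open>r x\<close> in row \<open>x\<close> of \<open>G'\<close>;
      along the characteristic both terms are driven by \<open>G\<close>.\<close>
    have eq: "B.L (B.P a f) x = r x * A.L (B.P a f) x"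
      unfolding A.L_def B.L_def using x by (simp add: G' sum_distrib_left mult.assoc)
    have r0: "r x \<noteq> 0" using r[OF x] by auto
    have "((\<lambda>h. A.P (s - h) F x - B.P (a - h * (1 / r x)) f x) has_real_derivative
        A.L (A.P s F) x * (- 1) - B.L (B.P a f) x * (- (1 / r x))) (at 0)"
    proof (rule DERIV_diff)
      show "((\<lambda>h. A.P (s - h) F x) has_real_derivative A.L (A.P s F) x * (- 1)) (at 0)"
        by (rule DERIV_cong[OF A.P_deriv_chain[OF x, where d = "- 1"]])
           (auto intro!: derivative_eq_intros)
      show "((\<lambda>h. B.P (a - h * (1 / r x)) f x) has_real_derivative
          B.L (B.P a f) x * (- (1 / r x))) (at 0)"
        by (rule DERIV_cong[OF B.P_deriv_chain[OF x, where d = "- (1 / r x)"]])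
           (use r0 in \<open>auto intro!: derivative_eq_intros\<close>)
    qed
    moreover have "A.L (A.P s F) x * (- 1) - B.L (B.P a f) x * (- (1 / r x))
        = - (\<Sum>y\<in>\<Omega>. G x y * (A.P s F y - B.P a f y))"
      using r0 A.L_diff[of "A.P s F" "B.P a f" x] unfolding eq
      by (simp add: A.L_def[of "\<lambda>y. A.P s F y - B.P a f y"])
    ultimately show "((\<lambda>h. A.P (s - h) F x - B.P (a - h * (1 / r x)) f x) has_real_derivative
        - (\<Sum>y\<in>\<Omega>. G x y * (A.P s F y - B.P a f y))) (at 0)" by simp
  qed (use assms in \<open>auto intro: less_imp_le\<close>)
  then show ?thesis by simp
qed

section \<open>Reversible chains\<close>

lemma power2_add_le: "(a + b)\<^sup>2 \<le> 2 * a\<^sup>2 + 2 * (b::real)\<^sup>2"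
  using zero_le_power2[of "a - b"] by (simp add: power2_eq_square algebra_simps)

locale rev_chain = chain \<Omega> G for \<Omega> :: "'a set" and G +
  fixes \<pi> :: "'a \<Rightarrow> real"
  assumes \<pi>_pos: "x \<in> \<Omega> \<Longrightarrow> 0 < \<pi> x"
    and \<pi>_sum: "(\<Sum>x\<in>\<Omega>. \<pi> x) = 1"
    and rev: "reversible_chain \<Omega> G \<pi>"
begin

lemma \<pi>_nonneg: "x \<in> \<Omega> \<Longrightarrow> 0 \<le> \<pi> x"
  using \<pi>_pos by (simp add: less_imp_le)

section \<open>The weighted inner product and the Dirichlet form\<close>

definition ip :: "('a \<Rightarrow> real) \<Rightarrow> ('a \<Rightarrow> real) \<Rightarrow> real" where
  "ip f g = (\<Sum>x\<in>\<Omega>. \<pi> x * (f x * g x))"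

definition mean :: "('a \<Rightarrow> real) \<Rightarrow> real" where
  "mean f = (\<Sum>x\<in>\<Omega>. \<pi> x * f x)"

definition energy :: "('a \<Rightarrow> real) \<Rightarrow> real" where
  "energy f = - ip f (L f)"

text \<open>\<open>K\<close> is an upper bound for the relaxation time, the inverse of the spectral
  gap; it need not be optimal.\<close>

definition poincare :: "real \<Rightarrow> bool" where
  "poincare K \<longleftrightarrow> 0 < K \<and> (\<forall>f. mean f = 0 \<longrightarrow> ip f f \<le> K * energy f)"

lemma ip_commute: "ip f g = ip g f"
  by (simp add: ip_def mult.commute)

lemma ip_self_nonneg: "0 \<le> ip f f"
  unfolding ip_def by (intro sum_nonneg mult_nonneg_nonneg[of "\<pi> _"]) (auto simp: \<pi>_nonneg)

lemma ip_cong: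
  "(\<And>x. x \<in> \<Omega> \<Longrightarrow> f x = f' x) \<Longrightarrow> (\<And>x. x \<in> \<Omega> \<Longrightarrow> g x = g' x) \<Longrightarrow> ip f g = ip f' g'"
  unfolding ip_def by (simp cong: sum.cong)

lemma mean_eq_ip: "mean f = ip (\<lambda>_. 1) f"
  by (simp add: mean_def ip_def)

lemma mean_add: "mean (\<lambda>x. f x + g x) = mean f + mean g"
  and mean_diff: "mean (\<lambda>x. f x - g x) = mean f - mean g"
  and mean_cmult: "mean (\<lambda>x. c * f x) = c * mean f"
  by (simp_all add: mean_def algebra_simps sum.distrib sum_subtractf sum_distrib_left)

lemma mean_const [simp]: "mean (\<lambda>_. c) = c"
  using \<pi>_sum by (simp add: mean_def flip: sum_distrib_right)

lemma mean_mono: "(\<And>x. x \<in> \<Omega> \<Longrightarrow> f x \<le> g x) \<Longrightarrow> mean f \<le> mean g"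
  unfolding mean_def by (intro sum_mono mult_left_mono) (auto simp: \<pi>_nonneg)

lemma ip_self_mono: "(\<And>x. x \<in> \<Omega> \<Longrightarrow> \<bar>f x\<bar> \<le> \<bar>g x\<bar>) \<Longrightarrow> ip f f \<le> ip g g"
  unfolding ip_def by (intro sum_mono mult_left_mono) (auto simp: \<pi>_nonneg abs_le_square_iff simp flip: power2_eq_square)

lemma cauchy_schwarz: "(ip f g)\<^sup>2 \<le> ip f f * ip g g"
proof -
  have eq: "ip f g = (\<Sum>x\<in>\<Omega>. (sqrt (\<pi> x) * f x) * (sqrt (\<pi> x) * g x))" for f g
    unfolding ip_def
  proof (intro sum.cong refl)
    fix x assume "x \<in> \<Omega>"
    then have "\<pi> x = sqrt (\<pi> x) * sqrt (\<pi> x)" using \<pi>_nonneg by simp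
    then show "\<pi> x * (f x * g x) = sqrt (\<pi> x) * f x * (sqrt (\<pi> x) * g x)"
      by (metis mult.assoc mult.left_commute)
  qed
  show ?thesis
    using Cauchy_Schwarz_ineq_sum[of "\<lambda>x. sqrt (\<pi> x) * f x" "\<lambda>x. sqrt (\<pi> x) * g x" \<Omega>]
    unfolding eq by (simp add: power2_eq_square)
qed

lemma centered_self: "ip (\<lambda>x. f x - c) (\<lambda>x. f x - c) = ip f f - 2 * c * mean f + c\<^sup>2"
proof -
  have "ip (\<lambda>x. f x - c) (\<lambda>x. f x - c) = ip f f - 2 * c * mean f + mean (\<lambda>_. c\<^sup>2)"
    by (simp add: ip_def mean_def algebra_simps sum.distrib sum_subtractf sum_distrib_left
        power2_eq_square del: mean_const)
  then show ?thesis by simp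
qed

lemma ip_centered_le: "ip (\<lambda>x. f x - mean f) (\<lambda>x. f x - mean f) \<le> ip f f"
  by (simp add: centered_self power2_eq_square algebra_simps)

lemma sum_swap_reversible:
  "(\<Sum>x\<in>\<Omega>. \<Sum>y\<in>\<Omega>. \<pi> x * G x y * h x y) = (\<Sum>x\<in>\<Omega>. \<Sum>y\<in>\<Omega>. \<pi> x * G x y * h y x)"
  by (subst sum.swap, intro sum.cong refl) (use rev in \<open>simp add: reversible_chain_def\<close>)

lemma L_selfadjoint: "ip f (L g) = ip (L f) g"
proof -
  have "ip f (L g) = (\<Sum>x\<in>\<Omega>. \<Sum>y\<in>\<Omega>. \<pi> x * G x y * (f x * g y))"
    by (simp add: ip_def L_def sum_distrib_left algebra_simps)
  also have "\<dots> = (\<Sum>x\<in>\<Omega>. \<Sum>y\<in>\<Omega>. \<pi> x * G x y * (f y * g x))"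
    by (rule sum_swap_reversible)
  also have "\<dots> = ip (L f) g"
    by (simp add: ip_def L_def sum_distrib_left sum_distrib_right algebra_simps)
  finally show ?thesis .
qed

text \<open>After expanding the square, both pure squares sum to 0: one by the vanishing row sums,
  the other by reversibility.\<close>

lemma energy_eq: "energy f = (\<Sum>x\<in>\<Omega>. \<Sum>y\<in>\<Omega>. \<pi> x * G x y * (f x - f y)\<^sup>2) / 2"
proof -
  have zero: "(\<Sum>x\<in>\<Omega>. \<Sum>y\<in>\<Omega>. \<pi> x * G x y * (f x)\<^sup>2) = 0"
    using generatorD(4)[OF gen]
    by (auto simp flip: sum_distrib_left sum_distrib_right intro!: sum.neutral)
  then have zero': "(\<Sum>x\<in>\<Omega>. \<Sum>y\<in>\<Omega>. \<pi> x * G x y * (f y)\<^sup>2) = 0"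
    using sum_swap_reversible[of "\<lambda>x y. (f x)\<^sup>2"] by simp
  have "(\<Sum>x\<in>\<Omega>. \<Sum>y\<in>\<Omega>. \<pi> x * G x y * (f x - f y)\<^sup>2) =
      (\<Sum>x\<in>\<Omega>. \<Sum>y\<in>\<Omega>. \<pi> x * G x y * (f x)\<^sup>2) + (\<Sum>x\<in>\<Omega>. \<Sum>y\<in>\<Omega>. \<pi> x * G x y * (f y)\<^sup>2)
      - 2 * (\<Sum>x\<in>\<Omega>. \<Sum>y\<in>\<Omega>. \<pi> x * G x y * (f x * f y))"
    by (simp add: power2_diff sum_distrib_left algebra_simps sum.distrib sum_subtractf)
  also have "(\<Sum>x\<in>\<Omega>. \<Sum>y\<in>\<Omega>. \<pi> x * G x y * (f x * f y)) = ip f (L f)"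
    by (simp add: ip_def L_def sum_distrib_left algebra_simps)
  finally show ?thesis using zero zero' by (simp add: energy_def)
qed

lemma energy_term_nonneg: "x \<in> \<Omega> \<Longrightarrow> y \<in> \<Omega> \<Longrightarrow> 0 \<le> \<pi> x * G x y * (f x - f y)\<^sup>2"
  using generatorD(3)[OF gen, of x y] \<pi>_nonneg[of x] by (cases "x = y") auto

lemma energy_nonneg: "0 \<le> energy f"
  unfolding energy_eq by (auto intro!: sum_nonneg energy_term_nonneg)

section \<open>Self-adjointness of the semigroup and monotonicity of norm and energy\<close>

lemma ip_deriv:
  assumes "\<And>x. x \<in> \<Omega> \<Longrightarrow> ((\<lambda>t. u t x) has_real_derivative u' x) (at t)"
    and "\<And>x. x \<in> \<Omega> \<Longrightarrow> ((\<lambda>t. v t x) has_real_derivative v' x) (at t)"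
  shows "((\<lambda>t. ip (u t) (v t)) has_real_derivative ip u' (v t) + ip (u t) v') (at t)"
proof -
  have "((\<lambda>t. ip (u t) (v t)) has_real_derivative
      (\<Sum>x\<in>\<Omega>. \<pi> x * (u' x * v t x + v' x * u t x))) (at t)"
    unfolding ip_def by (intro DERIV_sum DERIV_cmult DERIV_mult assms)
  also have "(\<Sum>x\<in>\<Omega>. \<pi> x * (u' x * v t x + v' x * u t x)) = ip u' (v t) + ip (u t) v'"
    by (simp add: ip_def algebra_simps sum.distrib)
  finally show ?thesis .
qed

lemma L_P_deriv: "x \<in> \<Omega> \<Longrightarrow> ((\<lambda>t. L (P t f) x) has_real_derivative L (L (P t f)) x) (at t)"
  unfolding L_def[of "P _ f" x] L_def[of "L (P t f)"] by (intro DERIV_sum DERIV_cmult P_deriv)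

lemma P_selfadjoint:
  assumes "0 \<le> t"
  shows "ip f (P t g) = ip (P t f) g"
proof -
  \<comment> \<open>Interpolation between the two sides; the derivative vanishes because
    \<open>L\<close> is self-adjoint.\<close>
  define k where "k = (\<lambda>s. ip (P s f) (P (t - s) g))"
  have "(k has_real_derivative 0) (at s)" for s
  proof -
    have "(k has_real_derivative ip (L (P s f)) (P (t - s) g)
        + ip (P s f) (\<lambda>x. L (P (t - s) g) x * (- 1))) (at s)"
      unfolding k_def
      by (intro ip_deriv P_deriv P_deriv_chain) (auto intro!: derivative_eq_intros)
    also have "ip (P s f) (\<lambda>x. L (P (t - s) g) x * (- 1)) = - ip (P s f) (L (P (t - s) g))"
      by (simp add: ip_def sum_negf)
    finally show ?thesis by (simp add: L_selfadjoint)
  qed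
  then have "k 0 = k t" by (intro DERIV_isconst_all) blast
  then show ?thesis by (simp add: k_def cong: ip_cong)
qed

lemma mean_P: "0 \<le> t \<Longrightarrow> mean (P t f) = mean f"
  unfolding mean_eq_ip by (subst P_selfadjoint) (auto cong: ip_cong)

lemma ip_P_deriv:
  "((\<lambda>t. ip (P t f) (P t f)) has_real_derivative - 2 * energy (P t f)) (at t)"
  by (rule DERIV_cong[OF ip_deriv[OF P_deriv P_deriv]])
     (auto simp: energy_def ip_commute)

lemma energy_P_deriv:
  "((\<lambda>t. energy (P t f)) has_real_derivative - 2 * ip (L (P t f)) (L (P t f))) (at t)"
  unfolding energy_def
  by (rule DERIV_cong[OF DERIV_minus[OF ip_deriv[OF P_deriv L_P_deriv]]])
     (auto simp: L_selfadjoint)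

lemma ip_P_antimono: "s \<le> t \<Longrightarrow> ip (P t f) (P t f) \<le> ip (P s f) (P s f)"
  by (rule DERIV_nonpos_imp_nonincreasing) (auto intro!: exI ip_P_deriv energy_nonneg)

lemma ip_P_le: "0 \<le> t \<Longrightarrow> ip (P t f) (P t f) \<le> ip f f"
  using ip_P_antimono[of 0 t f] by (simp cong: ip_cong)

lemma energy_P_antimono: "s \<le> t \<Longrightarrow> energy (P t f) \<le> energy (P s f)"
  by (rule DERIV_nonpos_imp_nonincreasing) (auto intro!: exI energy_P_deriv ip_self_nonneg)

lemma energy_cong: "(\<And>x. x \<in> \<Omega> \<Longrightarrow> f x = g x) \<Longrightarrow> energy f = energy g"
  unfolding energy_def by (auto intro!: ip_cong L_cong)

text \<open>The drop is \<open>2 * t\<close> times the energy at an intermediate time, and the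
  energy decreases along the semigroup.\<close>

lemma ip_P_drop:
  assumes "0 < t"
  shows "ip f f - ip (P t f) (P t f) \<le> 2 * t * energy f"
    and "2 * t * energy (P t f) \<le> ip f f - ip (P t f) (P t f)"
proof -
  obtain z where z: "0 < z" "z < t"
    "ip (P t f) (P t f) - ip (P 0 f) (P 0 f) = (t - 0) * (- 2 * energy (P z f))"
    using MVT2[OF assms, of "\<lambda>t. ip (P t f) (P t f)" "\<lambda>t. - 2 * energy (P t f)"] ip_P_deriv
    by blast
  then have eq: "ip f f - ip (P t f) (P t f) = 2 * t * energy (P z f)" by (simp cong: ip_cong)
  have "energy (P z f) \<le> energy f"
    using energy_P_antimono[of 0 z f] z(1) energy_cong[of "P 0 f" f] by simp
  then show "ip f f - ip (P t f) (P t f) \<le> 2 * t * energy f"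
    unfolding eq using assms by simp
  show "2 * t * energy (P t f) \<le> ip f f - ip (P t f) (P t f)"
    unfolding eq using assms energy_P_antimono[of z t f] z by simp
qed

section \<open>Poincare inequalities, exponential decay and contraction\<close>

lemma poincare_decay:
  assumes K: "poincare K" and mean: "mean f = 0" and t: "0 \<le> t"
  shows "ip (P t f) (P t f) \<le> exp (- (2 * t / K)) * ip f f"
proof -
  have K0: "0 < K" using K by (simp add: poincare_def)
  define k where "k = (\<lambda>t. exp (2 * t / K) * ip (P t f) (P t f))"
  have "k t \<le> k 0"
  proof (rule DERIV_nonpos_imp_nonincreasing[OF t])
    fix s :: real assume s: "0 \<le> s"
    have "(k has_real_derivative exp (2 * s / K) * (2 / K) * ip (P s f) (P s f)
        + - 2 * energy (P s f) * exp (2 * s / K)) (at s)"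
      unfolding k_def
      by (rule DERIV_mult[OF _ ip_P_deriv]) (use K0 in \<open>auto intro!: derivative_eq_intros\<close>)
    moreover have "ip (P s f) (P s f) \<le> K * energy (P s f)"
      using K mean s by (simp add: poincare_def mean_P)
    then have "exp (2 * s / K) * (2 / K) * ip (P s f) (P s f)
        \<le> exp (2 * s / K) * (2 / K) * (K * energy (P s f))"
      using K0 by (intro mult_left_mono) auto
    ultimately show "\<exists>y. (k has_real_derivative y) (at s) \<and> y \<le> 0"
      using K0 by (intro exI conjI) (assumption, simp add: algebra_simps)
  qed
  then have "exp (2 * t / K) * ip (P t f) (P t f) \<le> ip f f"
    by (simp add: k_def cong: ip_cong)
  then show ?thesis by (simp add: exp_minus field_simps)
qed

text \<open>The norm drops by at most \<open>2 * t\<close> times the energy, and a contraction makes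
  this drop a fixed fraction of the norm.\<close>

lemma contraction_imp_poincare:
  assumes "0 < t" "q < 1"
    and "\<And>f. mean f = 0 \<Longrightarrow> ip (P t f) (P t f) \<le> q * ip f f"
  shows "poincare (2 * t / (1 - q))"
  unfolding poincare_def
proof (intro conjI allI impI)
  show "0 < 2 * t / (1 - q)" using assms by simp
  fix f assume "mean f = 0"
  then have "(1 - q) * ip f f \<le> 2 * t * energy f"
    using assms(3)[of f] ip_P_drop(1)[OF \<open>0 < t\<close>, of f] by (simp add: algebra_simps)
  then show "ip f f \<le> 2 * t / (1 - q) * energy f"
    using assms by (simp add: field_simps)
qed

text \<open>By reversibility and Cauchy--Schwarz, \<open>ip (P (k t) f) (P (k t) f)\<close> is log-convex in \<open>k\<close>;
  hence its first ratio is at most its exponential rate, which may be measured in any norm.\<close>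

lemma sup_contraction_imp_ip_contraction:
  assumes t: "0 \<le> t" and q: "0 < q"
    and contr: "\<And>f x. mean f = 0 \<Longrightarrow> (\<And>x. x \<in> \<Omega> \<Longrightarrow> \<bar>f x\<bar> \<le> 1) \<Longrightarrow> x \<in> \<Omega> \<Longrightarrow> \<bar>P t f x\<bar> \<le> q"
    and mean: "mean f = 0"
  shows "ip (P t f) (P t f) \<le> q\<^sup>2 * ip f f"
proof (rule ccontr)
  define a where "a = (\<lambda>k. ip (P (real k * t) f) (P (real k * t) f))"
  assume neg: "\<not> ip (P t f) (P t f) \<le> q\<^sup>2 * ip f f"
  have a0: "a 0 = ip f f" and a1: "a 1 = ip (P t f) (P t f)" by (simp_all add: a_def One_nat_def[symmetric] del: One_nat_def cong: ip_cong)
  have "ip f f > 0"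
  proof (rule ccontr)
    assume "\<not> ip f f > 0"
    then have "ip f f = 0" using ip_self_nonneg[of f] by simp
    then show False using neg ip_P_le[OF t, of f] by simp
  qed
  then have a0_pos: "0 < a 0" by (simp add: a0)
  define \<rho> where "\<rho> = a 1 / a 0"
  have \<rho>: "q\<^sup>2 < \<rho>" using neg a0_pos by (simp only: \<rho>_def a0 a1 pos_less_divide_eq not_le)
  have \<rho>_pos: "0 < \<rho>" using \<rho> q by (smt (verit) zero_less_power)
  have step: "P (real (Suc k) * t) f x = P t (P (real k * t) f) x" if "x \<in> \<Omega>" for k x
    using P_semigroup[of t "real k * t" x f] t that by (simp add: algebra_simps)
  have logconvex: "(a (Suc k))\<^sup>2 \<le> a k * a (Suc (Suc k))" for k
  proof -
    let ?u = "P (real k * t) f"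
    have "a (Suc k) = ip (P t ?u) (P t ?u)"
      unfolding a_def using step by (intro ip_cong) auto
    also have "\<dots> = ip ?u (P t (P t ?u))" using P_selfadjoint[OF t] by simp
    also have "\<dots> = ip ?u (P (real (Suc (Suc k)) * t) f)"
      by (intro ip_cong refl) (simp only: step, rule P_cong, simp only: step)
    finally show ?thesis using cauchy_schwarz by (simp add: a_def)
  qed
  \<comment> \<open>Log-convexity makes the ratios \<open>a (Suc k) / a k\<close> nondecreasing, so
    all are at least the first one, \<open>\<rho>\<close>.\<close>
  have growth: "0 < a k \<and> \<rho> * a k \<le> a (Suc k)" for k
  proof (induction k)
    case 0
    then show ?case using a0_pos by (simp add: \<rho>_def)
  next
    case (Suc k)
    then have pos: "0 < a (Suc k)" using \<rho>_pos by (smt (verit) mult_pos_pos)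
    have "\<rho> * a k * a (Suc k) \<le> a (Suc k) * a (Suc k)"
      using Suc pos by (intro mult_right_mono) auto
    also have "\<dots> \<le> a k * a (Suc (Suc k))" using logconvex[of k] by (simp add: power2_eq_square)
    finally have "a k * (\<rho> * a (Suc k)) \<le> a k * a (Suc (Suc k))" by (simp add: algebra_simps)
    then show ?case using Suc pos by (simp add: mult_le_cancel_left_pos)
  qed
  have lower: "\<rho> ^ k * a 0 \<le> a k" for k
  proof (induction k)
    case (Suc k)
    then have "\<rho> * (\<rho> ^ k * a 0) \<le> \<rho> * a k" using \<rho>_pos by (intro mult_left_mono) auto
    then show ?case using growth[of k] by (simp add: algebra_simps)
  qed simp
  define B where "B = (\<Sum>x\<in>\<Omega>. \<bar>f x\<bar>) + 1"
  have B: "0 < B" unfolding B_def by (smt (verit) sum_nonneg abs_ge_zero)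
  have "mean (P (real k * t) f) = 0 \<and> (\<forall>x\<in>\<Omega>. \<bar>P (real k * t) f x\<bar> \<le> q ^ k * B)" for k
  proof (induction k)
    case 0
    have "\<bar>f x\<bar> \<le> B" if "x \<in> \<Omega>" for x
      using member_le_sum[OF that, of "\<lambda>x. \<bar>f x\<bar>"] by (simp add: B_def)
    then show ?case using mean by (auto simp: mean_def)
  next
    case (Suc k)
    define c where "c = q ^ k * B"
    let ?u = "P (real k * t) f"
    have c: "0 < c" using q B by (simp add: c_def)
    have "\<bar>P (real (Suc k) * t) f x\<bar> \<le> q ^ Suc k * B" if x: "x \<in> \<Omega>" for x
    proof -
      have "\<bar>P t (\<lambda>y. 1 / c * ?u y) x\<bar> \<le> q"
      proof (rule contr[OF _ _ x])
        show "mean (\<lambda>y. 1 / c * ?u y) = 0" using Suc by (simp only: mean_cmult)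
        fix y assume "y \<in> \<Omega>"
        then show "\<bar>1 / c * ?u y\<bar> \<le> 1" using Suc c by (simp add: abs_mult pos_divide_le_eq c_def[symmetric])
      qed
      then have "\<bar>P t ?u x\<bar> / c \<le> q" unfolding P_cmult using c by (simp add: abs_mult)
      then have "\<bar>P t ?u x\<bar> \<le> q * c" using c by (simp only: pos_divide_le_eq)
      then show ?thesis using step[OF x, of k] by (simp add: c_def mult.assoc)
    qed
    moreover have "mean (P (real (Suc k) * t) f) = 0" using mean mean_P t by simp
    ultimately show ?case by blast
  qed
  then have "a k \<le> ip (\<lambda>_. q ^ k * B) (\<lambda>_. q ^ k * B)" for k
    unfolding a_def using q B by (intro ip_self_mono) simp
  moreover have "ip (\<lambda>_. c) (\<lambda>_. c) = c\<^sup>2" for c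
    using \<pi>_sum by (simp add: ip_def power2_eq_square flip: sum_distrib_right)
  ultimately have upper: "a k \<le> (q\<^sup>2) ^ k * B\<^sup>2" for k
    by (simp add: power_mult_distrib power_mult[symmetric] mult.commute)
  \<comment> \<open>As \<open>\<rho>\<close> exceeds \<open>q\<^sup>2\<close>, the lower bound
    overtakes the upper one for large \<open>n\<close>, however large \<open>B\<close> is.\<close>
  have "1 < \<rho> / q\<^sup>2" using \<rho> q by simp
  then obtain n where "B\<^sup>2 / a 0 < (\<rho> / q\<^sup>2) ^ n" using real_arch_pow by blast
  then have "(q\<^sup>2) ^ n * B\<^sup>2 < \<rho> ^ n * a 0" using q a0_pos by (simp add: power_divide field_simps)
  then show False using lower[of n] upper[of n] by simp
qed

text \<open>Along a path of positive rates, \<open>(f x - f y)\<^sup>2\<close> is bounded by a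
  multiple of the energy; averaging over pairs controls the variance. The constant depends on the
  chain and serves only for finiteness of the mixing times and uniqueness of the stationary
  distribution.\<close>

lemma irreducible_imp_poincare:
  assumes "irreducible_chain \<Omega> G"
  shows "\<exists>K. poincare K"
proof -
  have path: "\<exists>C\<ge>0. \<forall>f. (f x - f y)\<^sup>2 \<le> C * energy f"
    if "(x, y) \<in> {(u, v). u \<in> \<Omega> \<and> v \<in> \<Omega> \<and> 0 < G u v}\<^sup>*" for x y
    using that
  proof (induction rule: rtrancl_induct)
    case base
    show ?case by (rule exI[of _ 0]) auto
  next
    case (step y z)
    from step.IH obtain C where C: "C \<ge> 0" "\<And>f. (f x - f y)\<^sup>2 \<le> C * energy f" by blast
    have yz: "y \<in> \<Omega>" "z \<in> \<Omega>" "0 < \<pi> y * G y z" using step.hyps(2) \<pi>_pos by auto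
    let ?c = "2 / (\<pi> y * G y z)"
    have "(f x - f z)\<^sup>2 \<le> (2 * C + 2 * ?c) * energy f" for f
    proof -
      have "\<pi> y * G y z * (f y - f z)\<^sup>2 \<le> (\<Sum>v\<in>\<Omega>. \<pi> y * G y v * (f y - f v)\<^sup>2)"
        using yz by (intro member_le_sum[of z \<Omega> "\<lambda>v. \<pi> y * G y v * (f y - f v)\<^sup>2"] energy_term_nonneg) auto
      also have "\<dots> \<le> 2 * energy f"
        unfolding energy_eq using yz(1)
        by (simp, intro member_le_sum[of y \<Omega> "\<lambda>u. \<Sum>v\<in>\<Omega>. \<pi> u * G u v * (f u - f v)\<^sup>2"])
           (auto intro!: sum_nonneg energy_term_nonneg)
      finally have "(f y - f z)\<^sup>2 \<le> ?c * energy f" using yz by (simp add: field_simps)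
      moreover have "(f x - f z)\<^sup>2 \<le> 2 * (f x - f y)\<^sup>2 + 2 * (f y - f z)\<^sup>2"
        using power2_add_le[of "f x - f y" "f y - f z"] by simp
      ultimately show ?thesis using C(2)[of f] unfolding distrib_right by simp
    qed
    moreover have "0 \<le> 2 * C + 2 * ?c" using C(1) less_imp_le[OF yz(3)] by simp
    ultimately show ?case by blast
  qed
  define C where "C = (\<lambda>x y. SOME C. 0 \<le> C \<and> (\<forall>f. (f x - f y)\<^sup>2 \<le> C * energy f))"
  have "0 \<le> C x y \<and> (\<forall>f. (f x - f y)\<^sup>2 \<le> C x y * energy f)" if "x \<in> \<Omega>" "y \<in> \<Omega>" for x y
    unfolding C_def using path[of x y] assms that
    by (intro someI_ex[where P = "\<lambda>C. 0 \<le> C \<and> (\<forall>f. (f x - f y)\<^sup>2 \<le> C * energy f)"])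
       (auto simp: irreducible_chain_def)
  then have C: "\<And>x y. x \<in> \<Omega> \<Longrightarrow> y \<in> \<Omega> \<Longrightarrow> C x y \<ge> 0"
    "\<And>x y f. x \<in> \<Omega> \<Longrightarrow> y \<in> \<Omega> \<Longrightarrow> (f x - f y)\<^sup>2 \<le> C x y * energy f"
    by blast+
  define K where "K = (\<Sum>x\<in>\<Omega>. \<Sum>y\<in>\<Omega>. \<pi> x * \<pi> y * C x y) + 1"
  have "ip f f \<le> K * energy f" if "mean f = 0" for f
  proof -
    \<comment> \<open>For mean 0 the double average is \<open>2 * ip f f\<close>, of which half is
      enough.\<close>
    have "(\<Sum>x\<in>\<Omega>. \<Sum>y\<in>\<Omega>. \<pi> x * \<pi> y * (f x - f y)\<^sup>2)
        = (\<Sum>x\<in>\<Omega>. \<pi> x * ip (\<lambda>y. f y - f x) (\<lambda>y. f y - f x))"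
      unfolding ip_def sum_distrib_left
      by (intro sum.cong refl) (simp add: power2_eq_square algebra_simps)
    also have "\<dots> = mean (\<lambda>x. ip f f + (f x)\<^sup>2)"
      by (simp add: centered_self that) (simp add: mean_def)
    also have "\<dots> = ip f f + mean (\<lambda>x. (f x)\<^sup>2)" unfolding mean_add by simp
    also have "mean (\<lambda>x. (f x)\<^sup>2) = ip f f" by (simp add: mean_def ip_def power2_eq_square)
    finally have "ip f f \<le> (\<Sum>x\<in>\<Omega>. \<Sum>y\<in>\<Omega>. \<pi> x * \<pi> y * (f x - f y)\<^sup>2)"
      using ip_self_nonneg[of f] by simp
    also have "\<dots> \<le> (\<Sum>x\<in>\<Omega>. \<Sum>y\<in>\<Omega>. \<pi> x * \<pi> y * (C x y * energy f))"
      by (intro sum_mono mult_left_mono C) (auto intro!: mult_nonneg_nonneg \<pi>_nonneg)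
    also have "\<dots> = (\<Sum>x\<in>\<Omega>. \<Sum>y\<in>\<Omega>. \<pi> x * \<pi> y * C x y) * energy f"
      by (simp add: sum_distrib_right mult.assoc)
    also have "\<dots> \<le> K * energy f" using energy_nonneg by (simp add: K_def algebra_simps)
    finally show ?thesis .
  qed
  moreover have "0 < K"
    unfolding K_def using C \<pi>_nonneg by (intro add_nonneg_pos sum_nonneg mult_nonneg_nonneg) auto
  ultimately show ?thesis unfolding poincare_def by blast
qed

text \<open>A maximal inequality over a time window that is as long as the time that precedes it: then
  the \<open>ip\<close>-norm of \<open>t L P\<^sub>u f\<close> for \<open>u\<close> in the window is bounded on average by the one of \<open>f\<close>, and
  a one-dimensional Sobolev bound in the time variable suffices.\<close>

lemma window_maximal:
  assumes t: "0 < t"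
  obtains F where "\<And>x. x \<in> \<Omega> \<Longrightarrow> 0 \<le> F x"
    "\<And>x a. x \<in> \<Omega> \<Longrightarrow> t \<le> a \<Longrightarrow> a \<le> 2 * t \<Longrightarrow> \<bar>P a f x\<bar> \<le> F x"
    "ip F F \<le> 3 * ip f f"
proof -
  \<comment> \<open>By the inequality of arithmetic and geometric means, \<open>w\<close> dominates
    the derivative of \<open>(P u f x)\<^sup>2\<close>; the powers of \<open>t\<close> give both
    terms integrals of order \<open>ip f f\<close> over a window of length \<open>t\<close>.\<close>
  define w where "w = (\<lambda>x u. (P u f x)\<^sup>2 / t + t * (L (P u f) x)\<^sup>2)"
  define J where "J = (\<lambda>x. integral {t..2*t} (w x))"
  define F where "F = (\<lambda>x. sqrt ((P t f x)\<^sup>2 + J x))"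
  have w_nonneg: "0 \<le> w x u" for x u using t by (simp add: w_def)
  have w_int: "w x integrable_on {c..d}" if "x \<in> \<Omega>" for x c d
  proof (rule integrable_continuous_interval)
    have "continuous_on {c..d} (\<lambda>u. L (P u f) x)"
      using L_P_deriv[OF that] by (meson DERIV_isCont continuous_at_imp_continuous_on)
    then show "continuous_on {c..d} (w x)"
      unfolding w_def using t by (intro continuous_intros P_continuous[OF that]) auto
  qed
  \<comment> \<open>Outside \<open>\<Omega>\<close> integrability is not known; without it the
    integral has the default value 0.\<close>
  have J_nonneg: "0 \<le> J x" for x unfolding J_def 
    by (cases "w x integrable_on {t..2*t}")
       (auto intro: integral_nonneg simp: not_integrable_integral w_nonneg)
  have F_sq: "(F x)\<^sup>2 = (P t f x)\<^sup>2 + J x" for x using J_nonneg by (simp add: F_def)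
  show thesis
  proof
    show "0 \<le> F x" for x by (simp add: F_def J_nonneg)
    show "\<bar>P a f x\<bar> \<le> F x" if x: "x \<in> \<Omega>" and a: "t \<le> a" "a \<le> 2 * t" for x a
    proof -
      have int: "((\<lambda>u. 2 * P u f x * L (P u f) x) has_integral (P a f x)\<^sup>2 - (P t f x)\<^sup>2) {t..a}"
      proof (rule fundamental_theorem_of_calculus[OF a(1)])
        fix u
        have "((\<lambda>u. (P u f x)\<^sup>2) has_real_derivative 2 * P u f x * L (P u f) x) (at u)"
          by (rule DERIV_cong[OF DERIV_power[OF P_deriv[OF x]]]) simp
        then show "((\<lambda>u. (P u f x)\<^sup>2) has_vector_derivative 2 * P u f x * L (P u f) x)
            (at u within {t..a})"
          by (simp add: has_real_derivative_iff_has_vector_derivative has_vector_derivative_at_within)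
      qed
      have "2 * P u f x * L (P u f) x \<le> w x u" for u
      proof -
        have "0 \<le> (P u f x - t * L (P u f) x)\<^sup>2 / t" using t by simp
        then show ?thesis using t by (simp add: w_def power2_eq_square field_simps)
      qed
      then have "(P a f x)\<^sup>2 - (P t f x)\<^sup>2 \<le> integral {t..a} (w x)"
        by (rule has_integral_le[OF int integrable_integral[OF w_int[OF x]]])
      also have "\<dots> \<le> J x"
        unfolding J_def using w_int[OF x] w_nonneg a by (intro integral_subset_le) auto
      finally have "(P a f x)\<^sup>2 \<le> (P t f x)\<^sup>2 + J x" by simp
      then show ?thesis unfolding F_def by (intro real_le_rsqrt) simp
    qed
    have "ip F F = ip (P t f) (P t f) + (\<Sum>x\<in>\<Omega>. \<pi> x * J x)"
      by (simp add: ip_def F_sq algebra_simps sum.distrib flip: power2_eq_square)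
    also have "(\<Sum>x\<in>\<Omega>. \<pi> x * J x) \<le> ip f f + t / 4 * (2 * energy (P t f) - 2 * energy (P (2 * t) f))"
    proof (rule has_integral_le)
      show "((\<lambda>u. \<Sum>x\<in>\<Omega>. \<pi> x * w x u) has_integral (\<Sum>x\<in>\<Omega>. \<pi> x * J x)) {t..2*t}"
        unfolding J_def by (intro has_integral_sum has_integral_mult_right integrable_integral w_int) auto
      have 1: "((\<lambda>u. ip f f / t) has_integral ip f f) {t..2*t}"
        using has_integral_const_real[of "ip f f / t" t "2 * t"] t by simp
      have 2: "((\<lambda>u. t * ip (L (P u f)) (L (P u f))) has_integral
          (- (t / 2)) * energy (P (2 * t) f) - (- (t / 2)) * energy (P t f)) {t..2*t}"
      proof (rule fundamental_theorem_of_calculus)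
        fix u
        have "((\<lambda>u. - (t / 2) * energy (P u f)) has_real_derivative
            t * ip (L (P u f)) (L (P u f))) (at u)"
          by (rule DERIV_cong[OF DERIV_cmult[OF energy_P_deriv]]) simp
        then show "((\<lambda>u. - (t / 2) * energy (P u f)) has_vector_derivative
            t * ip (L (P u f)) (L (P u f))) (at u within {t..2*t})"
          by (simp add: has_real_derivative_iff_has_vector_derivative has_vector_derivative_at_within)
      qed (use t in simp)
      show "((\<lambda>u. ip f f / t + t * ip (L (P u f)) (L (P u f))) has_integral
          ip f f + t / 4 * (2 * energy (P t f) - 2 * energy (P (2 * t) f))) {t..2*t}"
        by (rule has_integral_eq_rhs[OF has_integral_add[OF 1 2]]) (simp add: algebra_simps)
      fix u assume u: "u \<in> {t..2*t}"
      have "(\<Sum>x\<in>\<Omega>. \<pi> x * w x u) = ip (P u f) (P u f) / t + t * ip (L (P u f)) (L (P u f))"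
        by (simp add: w_def ip_def algebra_simps sum.distrib sum_distrib_left sum_divide_distrib power2_eq_square)
      then show "(\<Sum>x\<in>\<Omega>. \<pi> x * w x u) \<le> ip f f / t + t * ip (L (P u f)) (L (P u f))"
        using ip_P_le[of u f] u t by (simp add: divide_right_mono)
    qed
    also have "t / 4 * (2 * energy (P t f) - 2 * energy (P (2 * t) f)) \<le> t / 4 * (2 * energy (P t f))"
      using t energy_nonneg by (intro mult_left_mono) auto
    \<comment> \<open>The energy at time \<open>t\<close> is paid for by the drop of the norm on
      \<open>[0, t]\<close>, the time before the window.\<close>
    also have "t / 4 * (2 * energy (P t f)) \<le> ip f f"
      using ip_P_drop(2)[OF t, of f] ip_self_nonneg[of f] ip_self_nonneg[of "P t f"] by simp
    finally show "ip F F \<le> 3 * ip f f" using ip_P_le[of t f] t by simp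
  qed
qed

end

section \<open>Densities, relative entropy, and contraction at the mixing times\<close>

context rev_chain
begin

definition rel_density :: "real \<Rightarrow> 'a \<Rightarrow> 'a \<Rightarrow> real" where
  "rel_density t x y = transition \<Omega> G t x y / \<pi> y"

lemma transition_eq: "y \<in> \<Omega> \<Longrightarrow> transition \<Omega> G t x y = \<pi> y * rel_density t x y"
  using \<pi>_pos[of y] by (simp add: rel_density_def)

lemma P_eq_ip: "P t f x = ip (rel_density t x) f"
  unfolding P_def ip_def by (intro sum.cong refl) (simp add: transition_eq)

lemma density_nonneg: "0 \<le> t \<Longrightarrow> x \<in> \<Omega> \<Longrightarrow> y \<in> \<Omega> \<Longrightarrow> 0 \<le> rel_density t x y"
  using transition_nonneg[of t x y] \<pi>_pos[of y] by (simp add: rel_density_def)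

lemma mean_density: "0 \<le> t \<Longrightarrow> x \<in> \<Omega> \<Longrightarrow> mean (rel_density t x) = 1"
  using P_const[of t x 1] by (simp add: P_eq_ip mean_eq_ip ip_commute)

text \<open>By reversibility, densities evolve under the same semigroup as functions: test against
  the point mass at \<open>y\<close> and move \<open>P t\<close> to the other side.\<close>

lemma density_add:
  assumes "0 \<le> s" "0 \<le> t" "x \<in> \<Omega>" "y \<in> \<Omega>"
  shows "rel_density (s + t) x y = P t (rel_density s x) y"
proof -
  define \<delta> where "\<delta> = (\<lambda>z. if z = y then 1 else 0 :: real)"
  have \<delta>: "ip f \<delta> = \<pi> y * f y" for f
    using assms(4) by (simp add: ip_def \<delta>_def if_distrib[of "\<lambda>c. _ * c"] cong: if_cong)
  have "ip (rel_density (s + t) x) \<delta> = P s (P t \<delta>) x"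
    using P_semigroup assms by (simp flip: P_eq_ip)
  also have "\<dots> = ip (P t (rel_density s x)) \<delta>"
    using P_selfadjoint assms by (simp add: P_eq_ip[of s])
  finally show ?thesis using \<pi>_pos[OF assms(4)] by (simp add: \<delta>)
qed

abbreviation l2_dist :: "real \<Rightarrow> 'a \<Rightarrow> real" where
  "l2_dist t x \<equiv> l2_norm \<Omega> \<pi> (\<lambda>y. transition \<Omega> G t x y - \<pi> y)"

abbreviation ent :: "real \<Rightarrow> 'a \<Rightarrow> real" where
  "ent t x \<equiv> rel_entropy \<Omega> (transition \<Omega> G t x) \<pi>"

lemma l2_dist_eq: "l2_dist t x = sqrt (ip (\<lambda>y. rel_density t x y - 1) (\<lambda>y. rel_density t x y - 1))"
  unfolding l2_norm_def ip_def
  by (intro arg_cong[of _ _ sqrt] sum.cong refl)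
     (use \<pi>_pos in \<open>force simp: rel_density_def power2_eq_square diff_divide_distrib\<close>)

lemma l2_dist_sq: "(l2_dist t x)\<^sup>2 = ip (\<lambda>y. rel_density t x y - 1) (\<lambda>y. rel_density t x y - 1)"
  by (simp add: l2_dist_eq ip_self_nonneg)

lemma ip_density: "0 \<le> t \<Longrightarrow> x \<in> \<Omega> \<Longrightarrow> ip (rel_density t x) (rel_density t x) = 1 + (l2_dist t x)\<^sup>2"
  by (simp add: l2_dist_sq centered_self mean_density)

lemma centered_density_add:
  assumes "0 \<le> s" "0 \<le> t" "x \<in> \<Omega>" "y \<in> \<Omega>"
  shows "rel_density (s + t) x y - 1 = P t (\<lambda>y. rel_density s x y - 1) y"
  using assms by (simp add: density_add P_diff)

lemma l2_dist_antimono: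
  assumes "0 \<le> s" "s \<le> t" "x \<in> \<Omega>"
  shows "l2_dist t x \<le> l2_dist s x"
  unfolding l2_dist_eq
proof (rule real_sqrt_le_mono)
  let ?d = "\<lambda>t y. rel_density t x y - 1"
  have "ip (?d t) (?d t) = ip (P (t - s) (?d s)) (P (t - s) (?d s))"
    using centered_density_add[of s "t - s" x] assms by (intro ip_cong) auto
  also have "\<dots> \<le> ip (?d s) (?d s)" using assms by (intro ip_P_le) simp
  finally show "ip (?d t) (?d t) \<le> ip (?d s) (?d s)" .
qed

text \<open>The centered density has mean 0, hence decays by the Poincare inequality.\<close>

lemma l2_dist_tendsto_0:
  assumes "poincare K" "x \<in> \<Omega>"
  shows "((\<lambda>t. l2_dist t x) \<longlongrightarrow> 0) at_top"
proof -
  let ?d = "\<lambda>t y. rel_density t x y - 1"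
  have K: "0 < K" using assms by (simp add: poincare_def)
  have "(l2_dist t x)\<^sup>2 \<le> exp (- (2 * t / K)) * ip (?d 0) (?d 0)" if "0 \<le> t" for t
  proof -
    have "(l2_dist t x)\<^sup>2 = ip (P t (?d 0)) (P t (?d 0))"
      unfolding l2_dist_sq using centered_density_add[of 0 t x] assms that by (intro ip_cong) auto
    also have "\<dots> \<le> exp (- (2 * t / K)) * ip (?d 0) (?d 0)"
      using assms that by (intro poincare_decay) (auto simp: mean_diff mean_density)
    finally show ?thesis .
  qed
  then have ev: "\<forall>\<^sub>F t in at_top. (l2_dist t x)\<^sup>2 \<le> exp (- (2 * t / K)) * ip (?d 0) (?d 0)"
    by (rule eventually_mono[OF eventually_ge_at_top[of 0]])
  have "filterlim (\<lambda>t. - (2 * t / K)) at_bot at_top"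
    unfolding filterlim_uminus_at_bot
    using K filterlim_tendsto_pos_mult_at_top[OF tendsto_const[of "2 / K"] _ filterlim_ident[of at_top]]
    by simp
  then have "((\<lambda>t. exp (- (2 * t / K))) \<longlongrightarrow> 0) at_top"
    by (rule filterlim_compose[OF exp_at_bot])
  then have "((\<lambda>t. exp (- (2 * t / K)) * ip (?d 0) (?d 0)) \<longlongrightarrow> 0) at_top"
    by (auto intro: tendsto_eq_intros)
  then have "((\<lambda>t. (l2_dist t x)\<^sup>2) \<longlongrightarrow> 0) at_top"
    using tendsto_sandwich[OF _ ev tendsto_const] by simp
  then have "((\<lambda>t. sqrt ((l2_dist t x)\<^sup>2)) \<longlongrightarrow> sqrt 0) at_top" by (rule tendsto_real_sqrt)
  then show ?thesis by (simp add: l2_dist_eq ip_self_nonneg)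
qed

section \<open>Gibbs' variational inequality and relative entropy\<close>

lemma mean_exp_pos: "0 < mean (\<lambda>y. exp (g y))"
  unfolding mean_def using nonempty \<pi>_pos by (intro sum_pos) auto

text \<open>Apply \<open>ln q \<le> q - 1\<close> to the ratio \<open>q\<close> of the tilted law
  \<open>\<pi> y * exp (g y) / Z\<close> to \<open>\<mu> y\<close> and average over
  \<open>\<mu>\<close>; points with \<open>\<mu> y = 0\<close> are treated apart.\<close>

lemma gibbs:
  assumes \<mu>: "\<And>y. y \<in> \<Omega> \<Longrightarrow> 0 \<le> \<mu> y" "(\<Sum>y\<in>\<Omega>. \<mu> y) = 1"
  shows "(\<Sum>y\<in>\<Omega>. \<mu> y * g y) \<le> rel_entropy \<Omega> \<mu> \<pi> + ln (mean (\<lambda>y. exp (g y)))"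
proof -
  define Z where "Z = mean (\<lambda>y. exp (g y))"
  have Z: "0 < Z" unfolding Z_def by (rule mean_exp_pos)
  have "\<mu> y * (g y - ln (\<mu> y / \<pi> y) - ln Z) \<le> \<pi> y * exp (g y) / Z - \<mu> y" if y: "y \<in> \<Omega>" for y
  proof (cases "\<mu> y = 0")
    case True
    then show ?thesis using \<pi>_pos[OF y] Z by simp
  next
    case False
    then have \<mu>y: "0 < \<mu> y" using \<mu>(1)[OF y] by simp
    have \<pi>y: "0 < \<pi> y" using \<pi>_pos y by simp
    let ?q = "\<pi> y * exp (g y) / (Z * \<mu> y)"
    have "ln ?q = g y - ln (\<mu> y / \<pi> y) - ln Z"
      using \<mu>y \<pi>y Z by (simp add: ln_div ln_mult)
    moreover have "ln ?q \<le> ?q - 1" using \<mu>y \<pi>y Z by (intro ln_le_minus_one) simp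
    ultimately have "\<mu> y * (g y - ln (\<mu> y / \<pi> y) - ln Z) \<le> \<mu> y * (?q - 1)"
      using \<mu>y by (intro mult_left_mono) auto
    also have "\<dots> = \<pi> y * exp (g y) / Z - \<mu> y" using \<mu>y Z by (simp add: field_simps)
    finally show ?thesis .
  qed
  then have "(\<Sum>y\<in>\<Omega>. \<mu> y * (g y - ln (\<mu> y / \<pi> y) - ln Z)) \<le> (\<Sum>y\<in>\<Omega>. \<pi> y * exp (g y) / Z - \<mu> y)"
    by (rule sum_mono)
  also have "\<dots> = 0"
    using \<mu>(2) Z by (simp add: sum_subtractf Z_def mean_def flip: sum_divide_distrib)
  also have "(\<Sum>y\<in>\<Omega>. \<mu> y * (g y - ln (\<mu> y / \<pi> y) - ln Z)) =
      (\<Sum>y\<in>\<Omega>. \<mu> y * g y) - rel_entropy \<Omega> \<mu> \<pi> - (\<Sum>y\<in>\<Omega>. \<mu> y) * ln Z"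
    by (simp add: rel_entropy_def right_diff_distrib sum_subtractf sum_distrib_right)
  finally show ?thesis using \<mu>(2) by (simp add: Z_def)
qed

text \<open>A large \<open>a\<close> makes the entropy term small but asks for a higher exponential
  moment of \<open>g\<close>.\<close>

lemma gibbs_P:
  assumes "0 \<le> t" "x \<in> \<Omega>" "0 < a"
  shows "P t g x \<le> (ent t x + ln (mean (\<lambda>y. exp (a * g y)))) / a"
proof -
  have "a * P t g x \<le> ent t x + ln (mean (\<lambda>y. exp (a * g y)))"
    using gibbs[of "transition \<Omega> G t x" "\<lambda>y. a * g y"] assms transition_nonneg transition_sum
    by (simp add: P_def sum_distrib_left mult.left_commute)
  then show ?thesis using assms by (simp add: field_simps)
qed

lemma ent_eq: "ent t x = P t (\<lambda>y. ln (rel_density t x y)) x"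
  by (simp add: rel_entropy_def P_def rel_density_def)

text \<open>The optimal test function \<open>ln (rel_density t x y)\<close> has a junk value where the density vanishes,
  hence the shift by \<open>\<epsilon>\<close>.\<close>

lemma ent_antimono:
  assumes "0 \<le> s" "s \<le> t" "x \<in> \<Omega>"
  shows "ent t x \<le> ent s x"
proof (rule field_le_epsilon)
  fix \<epsilon> :: real assume \<epsilon>: "0 < \<epsilon>"
  define g where "g = (\<lambda>y. ln (rel_density t x y + \<epsilon>))"
  have t: "0 \<le> t" and ts: "0 \<le> t - s" using assms by auto
  \<comment> \<open>By Jensen's inequality and stationarity, the exponential moment of
    \<open>P (t - s) g\<close> is at most that of \<open>g\<close>.\<close>
  have "mean (\<lambda>y. exp (P (t - s) g y)) \<le> mean (P (t - s) (\<lambda>y. exp (g y)))"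
    using ts by (intro mean_mono exp_P_le)
  also have "\<dots> = mean (\<lambda>y. rel_density t x y + \<epsilon>)"
    unfolding mean_P[OF ts] unfolding mean_def g_def using density_nonneg[OF t assms(3)] \<epsilon>
    by (intro sum.cong refl) (simp add: add_nonneg_pos)
  also have "\<dots> = 1 + \<epsilon>" using t assms(3) by (simp add: mean_add mean_density)
  finally have "ln (mean (\<lambda>y. exp (P (t - s) g y))) \<le> ln (1 + \<epsilon>)"
    using mean_exp_pos \<epsilon> by simp
  also have "\<dots> \<le> \<epsilon>" using \<epsilon> by (intro ln_add_one_self_le_self) simp
  finally have ln_le: "ln (mean (\<lambda>y. exp (P (t - s) g y))) \<le> \<epsilon>" .
  have "ent t x \<le> P t g x"
    unfolding ent_eq P_def g_def
  proof (rule sum_mono)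
    fix y assume y: "y \<in> \<Omega>"
    show "transition \<Omega> G t x y * ln (rel_density t x y) \<le> transition \<Omega> G t x y * ln (rel_density t x y + \<epsilon>)"
    proof (cases "transition \<Omega> G t x y = 0")
      case False
      then have "0 < rel_density t x y"
        using density_nonneg[OF t assms(3) y] transition_eq[OF y, of t x] by fastforce
      then show ?thesis
        using transition_nonneg[OF t assms(3) y] \<epsilon> by (intro mult_left_mono) auto
    qed simp
  qed
  also have "\<dots> = P s (P (t - s) g) x" using P_semigroup[OF assms(1) ts assms(3)] by simp
  also have "\<dots> \<le> ent s x + \<epsilon>"
    using gibbs_P[of s x 1 "P (t - s) g"] assms ln_le by simp
  finally show "ent t x \<le> ent s x + \<epsilon>" .
qed

text \<open>Use \<open>ln p \<le> p - 1\<close>; the mean of the density \<open>p\<close> under the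
  law itself is its squared norm.\<close>

lemma ent_le_l2: assumes "0 \<le> t" "x \<in> \<Omega>" shows "ent t x \<le> (l2_dist t x)\<^sup>2"
proof -
  have "ent t x \<le> (\<Sum>y\<in>\<Omega>. transition \<Omega> G t x y * (rel_density t x y - 1))"
    unfolding ent_eq P_def
  proof (rule sum_mono)
    fix y assume y: "y \<in> \<Omega>"
    show "transition \<Omega> G t x y * ln (rel_density t x y) \<le> transition \<Omega> G t x y * (rel_density t x y - 1)"
    proof (cases "transition \<Omega> G t x y = 0")
      case False
      then have "0 < rel_density t x y"
        using density_nonneg[OF assms y] transition_eq[OF y, of t x] by fastforce
      then show ?thesis
        using transition_nonneg[OF assms y] by (intro mult_left_mono ln_le_minus_one) auto
    qed simp
  qed
  also have "\<dots> = P t (\<lambda>y. rel_density t x y - 1) x" by (simp add: P_def)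
  also have "\<dots> = ip (rel_density t x) (rel_density t x) - 1" using assms
    by (simp add: P_diff P_eq_ip[symmetric])
  finally show ?thesis using assms by (simp add: ip_density)
qed

text \<open>Cauchy--Schwarz against the density, whose squared norm is at most
  \<open>1 + 1 / 4\<close>; for \<open>f\<close> of mean 0 the constant 1 may first be subtracted
  from the density.\<close>

lemma P_le_of_l2:
  assumes "0 \<le> t" "x \<in> \<Omega>" "l2_dist t x \<le> 1 / 2"
  shows "(P t f x)\<^sup>2 \<le> 5 / 4 * ip f f" and "mean f = 0 \<Longrightarrow> (P t f x)\<^sup>2 \<le> 1 / 4 * ip f f"
proof -
  have "0 \<le> l2_dist t x" by (simp add: l2_dist_eq ip_self_nonneg)
  then have l2: "(l2_dist t x)\<^sup>2 \<le> 1 / 4"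
    using power_mono[OF assms(3), of 2] by (simp add: power_divide)
  have "(P t f x)\<^sup>2 \<le> ip (rel_density t x) (rel_density t x) * ip f f"
    unfolding P_eq_ip by (rule cauchy_schwarz)
  also have "\<dots> \<le> 5 / 4 * ip f f"
    using l2 assms ip_density[of t x] ip_self_nonneg by (intro mult_right_mono) auto
  finally show "(P t f x)\<^sup>2 \<le> 5 / 4 * ip f f" .
  assume "mean f = 0"
  then have "P t f x = ip (\<lambda>y. rel_density t x y - 1) f"
    unfolding P_eq_ip by (simp add: ip_def mean_def algebra_simps sum_subtractf)
  then have "(P t f x)\<^sup>2 \<le> (l2_dist t x)\<^sup>2 * ip f f"
    unfolding l2_dist_sq by (simp add: cauchy_schwarz)
  also have "\<dots> \<le> 1 / 4 * ip f f" using l2 ip_self_nonneg by (intro mult_right_mono)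
  finally show "(P t f x)\<^sup>2 \<le> 1 / 4 * ip f f" .
qed

text \<open>Averaged over the starting state, the pointwise bound is a contraction by
  \<open>1 / 4\<close>, and \<open>8 / 3 = 2 / (1 - 1 / 4)\<close>.\<close>

lemma l2_imp_poincare:
  assumes "0 < t" "\<And>x. x \<in> \<Omega> \<Longrightarrow> l2_dist t x \<le> 1 / 2"
  shows "poincare (8 / 3 * t)"
proof -
  have "ip (P t f) (P t f) \<le> 1 / 4 * ip f f" if "mean f = 0" for f
  proof -
    have "ip (P t f) (P t f) \<le> mean (\<lambda>_. 1 / 4 * ip f f)"
      using P_le_of_l2(2)[of t _ f] assms that
      unfolding ip_def[of "P t f"] mean_def
      by (intro sum_mono mult_left_mono \<pi>_nonneg) (auto simp: power2_eq_square)
    then show ?thesis by simp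
  qed
  then show ?thesis using contraction_imp_poincare[of t "1 / 4"] assms(1) by simp
qed

end

text \<open>The chord of \<open>exp\<close> over \<open>[-1, 1]\<close>; its linear term vanishes on
  averaging a function of mean 0.\<close>

lemma exp_le_cosh_sinh:
  assumes "\<bar>x\<bar> \<le> (1::real)"
  shows "exp x \<le> cosh 1 + sinh 1 * x"
proof -
  have "exp ((1 - (1 + x) / 2) *\<^sub>R (- 1) + ((1 + x) / 2) *\<^sub>R 1)
      \<le> (1 - (1 + x) / 2) * exp (- 1) + (1 + x) / 2 * exp 1"
    using assms by (intro convex_onD[OF exp_convex]) auto
  then show ?thesis by (simp add: cosh_def sinh_def field_simps)
qed

text \<open>The bound for \<open>P t f x\<close> from Gibbs' inequality if the relative entropy is at most \<open>1 / 2\<close>, \<open>f\<close> has mean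
  \<open>0\<close> and \<open>\<bar>f\<bar> \<le> 1\<close>: then \<open>mean (exp f) \<le> cosh 1\<close>.\<close>

definition ent_rate :: real where
  "ent_rate = 1 / 2 + ln (cosh 1)"

text \<open>The strict bound by 1 is what yields a contraction: \<open>cosh 1 < 13 / 8\<close>, and
  \<open>13 / 8\<close> is the quadratic Taylor lower bound for \<open>exp (1 / 2)\<close>.\<close>

lemma ent_rate: "0 < ent_rate" "ent_rate < 1"
proof -
  have "1 \<le> cosh (1::real)" by (rule cosh_real_ge_1)
  then show "0 < ent_rate" by (simp add: ent_rate_def add_pos_nonneg)
  have e: "exp 1 < (272 / 100 :: real)" by (rule e_less_272)
  have e': "5 / 2 \<le> exp (1::real)" using exp_lower_Taylor_quadratic[of 1] by simp
  have "exp (- 1 :: real) \<le> 2 / 5" using e' by (simp add: exp_minus field_simps)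
  then have "cosh (1::real) < 13 / 8" using e by (simp add: cosh_def)
  also have "13 / 8 \<le> exp (1 / 2 :: real)"
    using exp_lower_Taylor_quadratic[of "1 / 2"] by (simp add: power2_eq_square)
  finally have "ln (cosh 1) < ln (exp (1 / 2 :: real))"
    using \<open>1 \<le> cosh 1\<close> by (subst ln_less_cancel_iff) auto
  then show "ent_rate < 1" by (simp add: ent_rate_def)
qed

text \<open>The factor \<open>2 / (1 - q)\<close> of \<open>contraction_imp_poincare\<close> for
  \<open>q = ent_rate\<^sup>2\<close>.\<close>

definition ent_factor :: real where
  "ent_factor = 2 / (1 - ent_rate\<^sup>2)"

lemma ent_rate_sq: "ent_rate\<^sup>2 < 1"
  using ent_rate by (simp add: power_less_one_iff)

lemma ent_factor_pos: "0 < ent_factor"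
  using ent_rate_sq by (simp add: ent_factor_def)

text \<open>Gibbs' inequality for \<open>f\<close> and \<open>- f\<close> gives a contraction in the
  sup norm, which log-convexity turns into one in the weighted norm.\<close>

lemma (in rev_chain) ent_imp_poincare:
  assumes "0 < t" "\<And>x. x \<in> \<Omega> \<Longrightarrow> ent t x \<le> 1 / 2"
  shows "poincare (ent_factor * t)"
proof -
  have upper: "P t f x \<le> ent_rate"
    if f: "mean f = 0" "\<And>x. x \<in> \<Omega> \<Longrightarrow> \<bar>f x\<bar> \<le> 1" and x: "x \<in> \<Omega>" for f x
  proof -
    have "mean (\<lambda>y. exp (f y)) \<le> mean (\<lambda>y. cosh 1 + sinh 1 * f y)"
      using f by (intro mean_mono exp_le_cosh_sinh) auto
    also have "\<dots> = cosh 1" by (simp add: mean_add mean_cmult f(1))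
    finally have "ln (mean (\<lambda>y. exp (f y))) \<le> ln (cosh 1)"
      using mean_exp_pos by simp
    then show ?thesis
      using gibbs_P[of t x 1 f] assms x by (fastforce simp: ent_rate_def)
  qed
  have "ip (P t f) (P t f) \<le> ent_rate\<^sup>2 * ip f f" if "mean f = 0" for f
  proof (rule sup_contraction_imp_ip_contraction[OF _ ent_rate(1) _ that])
    fix f x assume f: "mean f = 0" "\<And>x. x \<in> \<Omega> \<Longrightarrow> \<bar>f x\<bar> \<le> 1" and x: "x \<in> \<Omega>"
    have "P t (\<lambda>y. - 1 * f y) x \<le> ent_rate"
      using f x by (intro upper) (simp_all only: mean_cmult, auto)
    then show "\<bar>P t f x\<bar> \<le> ent_rate" using upper[OF f x] unfolding P_cmult by simp
  qed (use assms in simp)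
  from contraction_imp_poincare[OF assms(1) ent_rate_sq this] show ?thesis
    by (simp add: ent_factor_def)
qed

section \<open>Changing the holding times\<close>

context rev_chain
begin

lemma poincare_centered:
  assumes "poincare K"
  shows "ip (\<lambda>x. f x - mean f) (\<lambda>x. f x - mean f) \<le> K * energy f"
proof -
  have "energy (\<lambda>x. f x - mean f) = energy f" by (simp add: energy_eq)
  moreover have "mean (\<lambda>x. f x - mean f) = 0" by (simp add: mean_diff)
  ultimately show ?thesis using assms unfolding poincare_def by fastforce
qed

lemma ip_le_mean_exp:
  assumes "\<And>x. x \<in> \<Omega> \<Longrightarrow> 0 \<le> f x"
  shows "ip f f \<le> mean (\<lambda>x. exp (f x))"
  unfolding ip_def mean_def
proof (intro sum_mono mult_left_mono \<pi>_nonneg)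
  fix x assume "x \<in> \<Omega>"
  then have f: "0 \<le> f x" using assms by simp
  have "f x \<le> 1 + f x / 2 + (f x / 2)\<^sup>2 / 2"
    using zero_le_power2[of "f x / 2 - 1"] by (simp add: power2_eq_square field_simps)
  also have "\<dots> \<le> exp (f x / 2)" using f by (intro exp_lower_Taylor_quadratic) simp
  finally have "f x * f x \<le> exp (f x / 2) * exp (f x / 2)" using f by (intro mult_mono) auto
  also have "\<dots> = exp (f x)" by (simp flip: exp_add)
  finally show "f x * f x \<le> exp (f x)" .
qed

end

lemma ln_le_half: "0 < x \<Longrightarrow> x \<le> 1 + 1 / 2 \<Longrightarrow> ln x \<le> (1 / 2 :: real)"
  using ln_le_minus_one[of x] by simp

text \<open>\<open>\<pi>'\<close> is proportional to \<open>\<pi> / r\<close>. In this form the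
  relation is symmetric in the two chains, up to replacing \<open>r\<close> and \<open>c\<close> by
  their inverses.\<close>

locale time_change =
  A: rev_chain \<Omega> G \<pi> + B: rev_chain \<Omega> G' \<pi>'
  for \<Omega> :: "'a set" and G \<pi> G' \<pi>' +
  fixes r :: "'a \<Rightarrow> real" and M c :: real
  assumes M: "1 \<le> M"
    and r: "x \<in> \<Omega> \<Longrightarrow> 1 / M < r x \<and> r x < M"
    and G': "x \<in> \<Omega> \<Longrightarrow> y \<in> \<Omega> \<Longrightarrow> G' x y = r x * G x y"
    and \<pi>': "x \<in> \<Omega> \<Longrightarrow> \<pi>' x * r x = c * \<pi> x"
begin

section \<open>Comparison of weights, norms and Poincare constants\<close>

lemma r_pos: "x \<in> \<Omega> \<Longrightarrow> 0 < r x"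
  using r[of x] M by (smt (verit) divide_pos_pos)

lemma inverse_r_le: "x \<in> \<Omega> \<Longrightarrow> 1 / r x \<le> M"
  using r[of x] r_pos[of x] M by (simp add: field_simps)

text \<open>\<open>c\<close> is the average of \<open>r\<close> under \<open>\<pi>'\<close>.\<close>

lemma c_bounds: "0 < c" "1 / M \<le> c"
proof -
  have "c = (\<Sum>x\<in>\<Omega>. c * \<pi> x)" by (simp add: A.\<pi>_sum flip: sum_distrib_left)
  also have "\<dots> = (\<Sum>x\<in>\<Omega>. \<pi>' x * r x)" by (intro sum.cong refl) (simp add: \<pi>')
  also have "\<dots> \<ge> (\<Sum>x\<in>\<Omega>. \<pi>' x * (1 / M))"
    using r by (intro sum_mono mult_left_mono) (auto simp: B.\<pi>_nonneg less_imp_le)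
  also have "(\<Sum>x\<in>\<Omega>. \<pi>' x * (1 / M)) = 1 / M" by (simp add: B.\<pi>_sum flip: sum_distrib_right sum_divide_distrib)
  finally show "1 / M \<le> c" .
  then show "0 < c" using M by (smt (verit) divide_pos_pos)
qed

lemma \<pi>_le: assumes x: "x \<in> \<Omega>" shows "\<pi> x \<le> M\<^sup>2 * \<pi>' x"
proof -
  have "\<pi> x = \<pi>' x * r x * (1 / c)" using \<pi>'[OF x] c_bounds by simp
  also have "\<dots> \<le> \<pi>' x * M * M"
  proof (rule mult_mono)
    show "\<pi>' x * r x \<le> \<pi>' x * M" using r[OF x] B.\<pi>_nonneg[OF x] by (intro mult_left_mono) auto
    show "1 / c \<le> M" using c_bounds M by (simp add: field_simps)
  qed (use c_bounds M B.\<pi>_nonneg[OF x] in auto)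
  finally show ?thesis by (simp add: power2_eq_square mult.commute mult.left_commute)
qed

lemma mean_le: "(\<And>x. x \<in> \<Omega> \<Longrightarrow> 0 \<le> f x) \<Longrightarrow> A.mean f \<le> M\<^sup>2 * B.mean f"
  unfolding A.mean_def B.mean_def sum_distrib_left mult.assoc[symmetric]
  by (intro sum_mono mult_right_mono \<pi>_le) auto

lemma ip_le: "A.ip f f \<le> M\<^sup>2 * B.ip f f"
  using mean_le[of "\<lambda>x. f x * f x"] by (simp add: A.mean_def B.mean_def A.ip_def B.ip_def)

text \<open>The Dirichlet forms differ exactly by the factor \<open>c\<close>, the variances by at
  most \<open>c * M\<close>. As \<open>c\<close> cancels, the loss is \<open>M\<close> and not
  \<open>M\<^sup>2\<close>.\<close>

lemma poincare_transfer:
  assumes K: "A.poincare K"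
  shows "B.poincare (M * K)"
  unfolding B.poincare_def
proof (intro conjI allI impI)
  show "0 < M * K" using K M by (simp add: A.poincare_def)
  fix f assume f: "B.mean f = 0"
  let ?h = "\<lambda>x. f x - A.mean f"
  have "B.energy f = (\<Sum>x\<in>\<Omega>. \<Sum>y\<in>\<Omega>. c * (\<pi> x * G x y * (f x - f y)\<^sup>2)) / 2"
    unfolding B.energy_eq
  proof (intro arg_cong[of _ _ "\<lambda>z. z / 2"] sum.cong refl)
    fix x y assume xy: "x \<in> \<Omega>" "y \<in> \<Omega>"
    have "\<pi>' x * G' x y = c * (\<pi> x * G x y)"
      using \<pi>'[OF xy(1)] G'[OF xy] by (metis mult.assoc)
    then show "\<pi>' x * G' x y * (f x - f y)\<^sup>2 = c * (\<pi> x * G x y * (f x - f y)\<^sup>2)" by simp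
  qed
  then have energy: "B.energy f = c * A.energy f"
    by (simp add: A.energy_eq flip: sum_distrib_left)
  have "B.ip f f \<le> B.ip ?h ?h" by (simp add: B.centered_self f)
  also have "\<dots> \<le> (\<Sum>x\<in>\<Omega>. c * M * \<pi> x * (?h x * ?h x))"
    unfolding B.ip_def
  proof (intro sum_mono mult_right_mono)
    fix x assume x: "x \<in> \<Omega>"
    have "\<pi>' x = c * \<pi> x * (1 / r x)" using \<pi>'[OF x] r_pos[OF x] by (simp add: field_simps)
    also have "\<dots> \<le> c * \<pi> x * M"
      using inverse_r_le[OF x] c_bounds A.\<pi>_nonneg[OF x] by (intro mult_left_mono) auto
    finally show "\<pi>' x \<le> c * M * \<pi> x" by (simp add: mult_ac)
  qed simp
  also have "\<dots> = c * M * A.ip ?h ?h" by (simp add: A.ip_def sum_distrib_left mult.assoc)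
  also have "\<dots> \<le> c * M * (K * A.energy f)"
    using A.poincare_centered[OF K] c_bounds M by (intro mult_left_mono) auto
  finally show "B.ip f f \<le> M * K * B.energy f" by (simp add: energy mult_ac)
qed

section \<open>Transfer of the mixing bounds from the first chain to the second\<close>

lemma transfer:
  assumes "0 \<le> t" "x \<in> \<Omega>"
    and "\<And>x a. x \<in> \<Omega> \<Longrightarrow> 0 \<le> a \<Longrightarrow> a \<le> M * t \<Longrightarrow> B.P a f x \<le> F x"
  shows "B.P (M * t) f x \<le> A.P t F x"
  using assms M r_pos inverse_r_le
  by (intro time_change_le[OF A.gen B.gen, of r M "M * t" f F t x] G') auto

text \<open>A time \<open>t\<close> shifts \<open>a\<close> into \<open>[t, 2 * t]\<close>, where
  the maximal inequality applies; the remaining time \<open>u\<close> produces the decay.\<close>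

lemma window:
  assumes "0 < t" "0 \<le> u" "B.poincare K'" "B.mean f = 0"
  obtains F where "\<And>x. x \<in> \<Omega> \<Longrightarrow> 0 \<le> F x"
    "\<And>x a. x \<in> \<Omega> \<Longrightarrow> 0 \<le> a \<Longrightarrow> a \<le> t \<Longrightarrow> \<bar>B.P a (B.P (t + u) f) x\<bar> \<le> F x"
    "B.ip F F \<le> 3 * (exp (- u / K'))\<^sup>2 * B.ip f f"
proof -
  obtain F where F: "\<And>x. x \<in> \<Omega> \<Longrightarrow> 0 \<le> F x"
    "\<And>x a. x \<in> \<Omega> \<Longrightarrow> t \<le> a \<Longrightarrow> a \<le> 2 * t \<Longrightarrow> \<bar>B.P a (B.P u f) x\<bar> \<le> F x"
    "B.ip F F \<le> 3 * B.ip (B.P u f) (B.P u f)"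
    using B.window_maximal[OF assms(1), of "B.P u f"] by blast
  show thesis
  proof
    fix x a assume a: "x \<in> \<Omega>" "0 \<le> a" "a \<le> t"
    have "B.P a (B.P (t + u) f) x = B.P (a + t) (B.P u f) x"
      using a assms B.P_semigroup[of a "t + u" x f] B.P_semigroup[of "a + t" u x f]
      by (simp add: add.assoc)
    then show "\<bar>B.P a (B.P (t + u) f) x\<bar> \<le> F x" using F(2)[of x "a + t"] a by simp
  next
    have "(exp (- u / K'))\<^sup>2 = exp (- (2 * u / K'))"
      by (simp flip: exp_of_nat_mult)
    then show "B.ip F F \<le> 3 * (exp (- u / K'))\<^sup>2 * B.ip f f"
      using F(3) B.poincare_decay[OF assms(3,4,2)] by simp
  qed (use F in auto)
qed

lemma l2_step:
  assumes t: "0 < t" and l2: "\<And>x. x \<in> \<Omega> \<Longrightarrow> A.l2_dist t x \<le> 1 / 2"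
  defines "m \<equiv> max 2 M"
  shows "\<exists>T\<ge>0. T \<le> 11 * M * ln m * t \<and> (\<forall>x\<in>\<Omega>. B.l2_dist T x \<le> 1 / 2)"
proof -
  define K' where "K' = M * (8 / 3 * t)"
  define t1 where "t1 = M * t"
  \<comment> \<open>This gives \<open>e = 1 / m ^ 3\<close>, so that \<open>e\<^sup>2\<close>
    absorbs the loss \<open>M\<^sup>2\<close> from the change of weights as well as the numerical
    constants.\<close>
  define u where "u = 3 * K' * ln m"
  define e where "e = exp (- u / K')"
  define T where "T = t1 + (t1 + u)"
  have m: "2 \<le> m" "M \<le> m" by (auto simp: m_def)
  have lnm: "2 / 3 \<le> ln m" using ln2_ge_two_thirds m by (smt (verit) ln_le_cancel_iff)
  have K': "0 < K'" "B.poincare K'"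
    using poincare_transfer[OF A.l2_imp_poincare[OF t l2]] M t by (simp_all add: K'_def)
  have pos: "0 < t1" "0 \<le> u" using M t lnm K' by (simp_all add: t1_def u_def)
  have "3 * ln m = ln (m ^ 3)" using m by (simp add: ln_realpow)
  then have "- u / K' = - ln (m ^ 3)" using K' by (simp add: u_def)
  then have "e = 1 / m ^ 3" using m by (simp add: e_def exp_minus inverse_eq_divide)
  then have "e\<^sup>2 * M\<^sup>2 = M\<^sup>2 / (m\<^sup>2 * m ^ 4)"
    by (simp add: power_divide flip: power_mult power_add)
  also have "\<dots> \<le> m\<^sup>2 / (m\<^sup>2 * 2 ^ 4)"
    using m M by (intro frac_le power_mono mult_left_mono) auto
  also have "\<dots> = 1 / 16" using m by simp
  finally have e: "M\<^sup>2 * e\<^sup>2 \<le> 1 / 16" by (simp add: mult.commute)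
  have "B.l2_dist T x \<le> 1 / 2" if x: "x \<in> \<Omega>" for x
  proof -
    have T0: "0 \<le> T" using pos by (simp add: T_def)
    let ?g = "\<lambda>y. B.rel_density T x y - 1"
    define N where "N = B.ip ?g ?g"
    have mean_g: "B.mean ?g = 0" using B.mean_density[OF T0 x] by (simp add: B.mean_diff)
    obtain F where F: "\<And>x. x \<in> \<Omega> \<Longrightarrow> 0 \<le> F x"
      "\<And>x a. x \<in> \<Omega> \<Longrightarrow> 0 \<le> a \<Longrightarrow> a \<le> t1 \<Longrightarrow> \<bar>B.P a (B.P (t1 + u) ?g) x\<bar> \<le> F x"
      "B.ip F F \<le> 3 * e\<^sup>2 * N"
      using window[OF pos K'(2) mean_g] unfolding N_def e_def by blast
    have N0: "0 \<le> N" by (simp add: N_def B.ip_self_nonneg)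
    \<comment> \<open>With the centered density as test function, its squared norm \<open>N\<close>
      becomes a value of the semigroup; bounding \<open>N\<^sup>2\<close> by a multiple of
      \<open>N\<close> then bounds \<open>N\<close>.\<close>
    have "B.ip ?g h = B.ip (B.rel_density T x) h - B.mean h" for h
      by (simp add: B.ip_def B.mean_def left_diff_distrib right_diff_distrib sum_subtractf)
    then have "N = B.P T ?g x" unfolding B.P_eq_ip N_def using mean_g by simp
    also have "\<dots> = B.P t1 (B.P (t1 + u) ?g) x"
      unfolding T_def using pos x by (intro B.P_semigroup) auto
    also have "\<dots> \<le> A.P t F x"
      unfolding t1_def using t x F(2)[unfolded t1_def] by (intro transfer) (auto simp: abs_le_iff)
    finally have "N\<^sup>2 \<le> (A.P t F x)\<^sup>2" using N0 by (intro power_mono)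
    also have "\<dots> \<le> 5 / 4 * A.ip F F" using A.P_le_of_l2(1) t x l2 by simp
    also have "\<dots> \<le> 5 / 4 * (M\<^sup>2 * (3 * e\<^sup>2 * N))"
      by (intro mult_left_mono order_trans[OF ip_le] F(3)) auto
    also have "\<dots> = 15 / 4 * (M\<^sup>2 * e\<^sup>2) * N" by simp
    also have "\<dots> \<le> 15 / 4 * (1 / 16) * N" using e N0 by (intro mult_right_mono mult_left_mono) auto
    also have "\<dots> \<le> 1 / 4 * N" using N0 by simp
    finally have "N * N \<le> 1 / 4 * N" by (simp add: power2_eq_square)
    then have "N \<le> 1 / 4"
      using N0 mult_right_le_imp_le[of N N "1 / 4"] by (cases "N = 0") simp_all
    then have "sqrt N \<le> sqrt ((1 / 2)\<^sup>2)" by (simp add: power_divide)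
    then show ?thesis unfolding B.l2_dist_eq N_def[symmetric] by simp
  qed
  moreover have "0 \<le> T" using pos by (simp add: T_def)
  moreover have "T \<le> 11 * M * ln m * t"
  proof -
    \<comment> \<open>The two runs of length \<open>t1\<close> thus cost at most
      \<open>3 * M * ln m * t\<close>, and \<open>u\<close> is \<open>8 * M * ln m * t\<close>:
      together 11.\<close>
    have "2 * (M * t) \<le> 3 * ln m * (M * t)" using lnm M t by (intro mult_right_mono) auto
    then show ?thesis by (simp add: T_def t1_def u_def K'_def algebra_simps)
  qed
  ultimately show ?thesis by blast
qed

text \<open>Unlike in \<open>l2_step\<close>, time \<open>T\<close> is spent twice: only an
  exponential moment of the test function is controlled, so a first run has to bound it from
  above.\<close>

lemma ent_step:
  assumes t: "0 < t" and ent: "\<And>x. x \<in> \<Omega> \<Longrightarrow> A.ent t x \<le> 1 / 2"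
  defines "m \<equiv> max 2 M"
  shows "\<exists>T\<ge>0. T \<le> (6 + 40 * ent_factor) * M * ln m * t \<and> (\<forall>x\<in>\<Omega>. B.ent T x \<le> 1 / 2)"
proof -
  define K' where "K' = M * (ent_factor * t)"
  define t1 where "t1 = M * t"
  \<comment> \<open>This gives \<open>e = 1 / m ^ 20\<close>. The second run fixes the size: there
    \<open>M\<^sup>2 * e \<le> 1 / 2 ^ 18\<close> has to bring
    \<open>12 * 3 ^ 8 * (M\<^sup>2 * e)\<close> below \<open>1 / 2\<close>.\<close>
  define u where "u = 20 * K' * ln m"
  define e where "e = exp (- u / K')"
  define T where "T = t1 + (t1 + u)"
  have m: "2 \<le> m" "M \<le> m" by (auto simp: m_def)
  have lnm: "2 / 3 \<le> ln m" using ln2_ge_two_thirds m by (smt (verit) ln_le_cancel_iff)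
  have K': "0 < K'" "B.poincare K'"
    using poincare_transfer[OF A.ent_imp_poincare[OF t ent]] M t ent_factor_pos
    by (simp_all add: K'_def)
  have pos: "0 < t1" "0 \<le> u" using M t lnm K' by (simp_all add: t1_def u_def)
  then have T0: "0 \<le> T" by (simp add: T_def)
  have e0: "0 < e" by (simp add: e_def)
  have "20 * ln m = ln (m ^ 20)" using m by (simp add: ln_realpow)
  then have "- u / K' = - ln (m ^ 20)" using K' by (simp add: u_def)
  then have "e = 1 / m ^ 20" using m by (simp add: e_def exp_minus inverse_eq_divide)
  then have "e * M\<^sup>2 = M\<^sup>2 / (m\<^sup>2 * m ^ 18)"
    by (simp flip: power_add)
  also have "\<dots> \<le> m\<^sup>2 / (m\<^sup>2 * 2 ^ 18)"
    using m M by (intro frac_le power_mono mult_left_mono) auto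
  also have "\<dots> = 1 / 2 ^ 18" using m by simp
  finally have e: "M\<^sup>2 * e \<le> 1 / 2 ^ 18" by (simp add: mult.commute)

  have step: "B.P T f x \<le> (1 / 2 + ln (A.mean (\<lambda>y. exp (a * F y)))) / a"
    if "0 < a" "x \<in> \<Omega>"
      and "\<And>x b. x \<in> \<Omega> \<Longrightarrow> 0 \<le> b \<Longrightarrow> b \<le> t1 \<Longrightarrow> B.P b (B.P (t1 + u) f) x \<le> F x" for f F x a
  proof -
    have "B.P T f x = B.P t1 (B.P (t1 + u) f) x"
      unfolding T_def using pos that by (intro B.P_semigroup) auto
    also have "\<dots> \<le> A.P t F x"
      unfolding t1_def using t that(2,3)[unfolded t1_def] by (intro transfer) auto
    also have "\<dots> \<le> (A.ent t x + ln (A.mean (\<lambda>y. exp (a * F y)))) / a"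
      using that t by (intro A.gibbs_P) auto
    also have "\<dots> \<le> (1 / 2 + ln (A.mean (\<lambda>y. exp (a * F y)))) / a"
      using ent that by (intro divide_right_mono) auto
    finally show ?thesis .
  qed

  txt \<open>Gibbs' inequality with \<open>a = 1 / 2\<close>, where an exponential moment of the majorant is finite,
    yields the uniform bound \<open>2\<close> at time \<open>T\<close>. With this bound the majorant is bounded for the second
    run of length \<open>T\<close>, so that \<open>a = 4\<close> is possible there.\<close>
  have bound: "B.P (T + T) (\<lambda>y. f y - B.mean f) x \<le> 1 / 4"
    if f: "\<And>y. y \<in> \<Omega> \<Longrightarrow> 0 \<le> f y" "B.mean (\<lambda>y. exp (f y)) \<le> 2" and x: "x \<in> \<Omega>" for f x
  proof -
    let ?f0 = "\<lambda>y. f y - B.mean f"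
    have mean0: "B.mean ?f0 = 0" by (simp add: B.mean_diff)
    have norm0: "B.ip ?f0 ?f0 \<le> 2"
      using B.ip_centered_le[of f] B.ip_le_mean_exp[of f] f by simp
    have mean_f: "0 \<le> B.mean f" using B.mean_mono[of "\<lambda>_. 0" f] f by simp
    have stage1: "B.P T ?f0 y \<le> 2" if y: "y \<in> \<Omega>" for y
    proof -
      obtain F where F: "\<And>x. x \<in> \<Omega> \<Longrightarrow> 0 \<le> F x"
        "\<And>x a. x \<in> \<Omega> \<Longrightarrow> 0 \<le> a \<Longrightarrow> a \<le> t1 \<Longrightarrow> \<bar>B.P a (B.P (t1 + u) ?f0) x\<bar> \<le> F x"
        "B.ip F F \<le> 3 * e\<^sup>2 * B.ip ?f0 ?f0"
        using window[OF pos K'(2) mean0] unfolding e_def by blast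
      \<comment> \<open>The square of \<open>?h\<close> is \<open>exp ?f0\<close>, of mean at most
        2. As \<open>?h\<close> is not centered, its majorant \<open>E\<close> is bounded in norm
        but need not be small.\<close>
      let ?h = "\<lambda>y. exp (?f0 y / 2)"
      obtain E where E: "\<And>x. x \<in> \<Omega> \<Longrightarrow> 0 \<le> E x"
        "\<And>x a. x \<in> \<Omega> \<Longrightarrow> t1 \<le> a \<Longrightarrow> a \<le> 2 * t1 \<Longrightarrow> \<bar>B.P a (B.P u ?h) x\<bar> \<le> E x"
        "B.ip E E \<le> 3 * B.ip (B.P u ?h) (B.P u ?h)"
        using B.window_maximal[OF pos(1), of "B.P u ?h"] by blast
      have "B.ip (B.P u ?h) (B.P u ?h) \<le> B.ip ?h ?h" using pos by (intro B.ip_P_le)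
      also have "\<dots> = B.mean (\<lambda>y. exp (?f0 y))"
        by (simp add: B.ip_def B.mean_def flip: exp_add)
      also have "\<dots> \<le> B.mean (\<lambda>y. exp (f y))" using mean_f by (intro B.mean_mono) simp
      finally have normE: "B.ip E E \<le> 6" using E(3) f by simp
      \<comment> \<open>\<open>F\<close> is small in norm, while the second bound, from Jensen's
        inequality, gives \<open>exp (H y / 2) \<le> max 1 (E y)\<close>; the minimum has both
        properties.\<close>
      define H where "H = (\<lambda>y. min (F y) (2 * ln (max 1 (E y))))"
      have main: "B.P T ?f0 y \<le> (1 / 2 + ln (A.mean (\<lambda>y. exp (1 / 2 * H y)))) / (1 / 2)"
      proof (rule step[OF _ y])
        fix x b assume x: "x \<in> \<Omega>" and b: "0 \<le> b" "b \<le> t1"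
        let ?v = "B.P b (B.P (t1 + u) ?f0) x"
        have eq: "B.P b (B.P (t1 + u) g) x = B.P (b + (t1 + u)) g x" for g
          using b pos x by (intro B.P_semigroup[symmetric]) auto
        have eq': "B.P (b + t1) (B.P u g) x = B.P (b + (t1 + u)) g x" for g
          using b pos x B.P_semigroup[of "b + t1" u x g] by (simp add: add.assoc)
        have "exp (?v / 2) = exp (B.P (b + (t1 + u)) (\<lambda>y. ?f0 y / 2) x)"
          using B.P_cmult[of "b + (t1 + u)" "1 / 2" ?f0 x] by (simp add: eq)
        also have "\<dots> \<le> B.P (b + (t1 + u)) ?h x" using b pos x by (intro B.exp_P_le) auto
        also have "\<dots> \<le> E x" using E(2)[OF x, of "b + t1"] b by (simp add: eq' abs_le_iff)
        also have "\<dots> \<le> max 1 (E x)" by simp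
        finally have "?v / 2 \<le> ln (max 1 (E x))" by (subst ln_ge_iff) auto
        moreover have "?v \<le> F x" using F(2)[OF x b] by simp
        ultimately show "?v \<le> H x" by (simp add: H_def)
      qed simp
      have "A.mean (\<lambda>y. exp (1 / 2 * H y)) \<le> 1 + 1 / 2"
      proof -
        have "exp (1 / 2 * H x) \<le> 1 + 1 / 2 * (F x * (1 + E x))" if x: "x \<in> \<Omega>" for x
        proof -
          let ?z = "H x / 2"
          have z: "0 \<le> ?z" "?z \<le> F x / 2" "?z \<le> ln (max 1 (E x))"
            using F(1)[OF x] by (auto simp: H_def)
          have "exp ?z \<le> max 1 (E x)" using z(3) by (subst (asm) ln_ge_iff) auto
          then have ez: "exp ?z \<le> 1 + E x" using E(1)[OF x] by simp
          have "exp ?z * (1 - ?z) \<le> exp ?z * exp (- ?z)"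
            using exp_ge_add_one_self[of "- ?z"] by (intro mult_left_mono) auto
          then have "exp ?z \<le> 1 + ?z * exp ?z" by (simp add: algebra_simps flip: exp_add)
          also have "\<dots> \<le> 1 + F x / 2 * (1 + E x)"
            using z ez F(1)[OF x] by (intro add_left_mono mult_mono) auto
          finally show ?thesis by simp
        qed
        then have "A.mean (\<lambda>y. exp (1 / 2 * H y)) \<le> A.mean (\<lambda>x. 1 + 1 / 2 * (F x * (1 + E x)))"
          by (rule A.mean_mono)
        also have "\<dots> = 1 + 1 / 2 * A.mean (\<lambda>x. F x * (1 + E x))"
          by (simp only: A.mean_add A.mean_cmult A.mean_const)
        also have "A.mean (\<lambda>x. F x * (1 + E x)) \<le> M\<^sup>2 * B.mean (\<lambda>x. F x * (1 + E x))"
          using F(1) E(1) by (intro mean_le) simp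
        also have "\<dots> \<le> M\<^sup>2 * (10 * e)"
        proof (rule mult_left_mono[OF power2_le_imp_le])
          have "B.ip (\<lambda>x. 1 + E x) (\<lambda>x. 1 + E x) \<le> B.mean (\<lambda>x. 2 + 2 * (E x)\<^sup>2)"
            unfolding B.ip_def B.mean_def
            using power2_add_le[of 1 "E _"]
            by (intro sum_mono mult_left_mono B.\<pi>_nonneg) (simp_all add: power2_eq_square)
          also have "\<dots> = 2 + 2 * B.ip E E"
            by (simp add: B.mean_add B.mean_cmult) (simp add: B.mean_def B.ip_def power2_eq_square)
          finally have "B.ip (\<lambda>x. 1 + E x) (\<lambda>x. 1 + E x) \<le> 14" using normE by simp
          moreover have "B.ip F F \<le> 6 * e\<^sup>2"
            using order_trans[OF F(3) mult_left_mono[OF norm0, of "3 * e\<^sup>2"]] by simp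
          ultimately have "B.ip F F * B.ip (\<lambda>x. 1 + E x) (\<lambda>x. 1 + E x) \<le> (6 * e\<^sup>2) * 14"
            by (intro mult_mono B.ip_self_nonneg) auto
          then have "(B.ip F (\<lambda>x. 1 + E x))\<^sup>2 \<le> (6 * e\<^sup>2) * 14"
            using B.cauchy_schwarz order_trans by blast
          also have "\<dots> \<le> (10 * e)\<^sup>2" by (simp add: power_mult_distrib)
          finally show "(B.mean (\<lambda>x. F x * (1 + E x)))\<^sup>2 \<le> (10 * e)\<^sup>2"
            by (simp add: B.mean_def B.ip_def)
        qed (use e0 in simp_all)
        finally have "A.mean (\<lambda>y. exp (1 / 2 * H y)) \<le> 1 + 5 * (M\<^sup>2 * e)"
          by (simp add: algebra_simps)
        then show ?thesis using e by simp
      qed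
      then have "ln (A.mean (\<lambda>y. exp (1 / 2 * H y))) \<le> 1 / 2"
        by (intro ln_le_half A.mean_exp_pos)
      then show ?thesis using main by simp
    qed
    define h where "h = B.P T ?f0"
    have mean_h: "B.mean h = 0" using mean0 T0 by (simp add: h_def B.mean_P)
    have norm_h: "B.ip h h \<le> 2" using B.ip_P_le[OF T0, of ?f0] norm0 by (simp add: h_def)
    obtain F where F: "\<And>x. x \<in> \<Omega> \<Longrightarrow> 0 \<le> F x"
      "\<And>x a. x \<in> \<Omega> \<Longrightarrow> 0 \<le> a \<Longrightarrow> a \<le> t1 \<Longrightarrow> \<bar>B.P a (B.P (t1 + u) h) x\<bar> \<le> F x"
      "B.ip F F \<le> 3 * e\<^sup>2 * B.ip h h"
      using window[OF pos K'(2) mean_h] unfolding e_def by blast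
    define H where "H = (\<lambda>y. min (F y) 2)"
    have "B.P (T + T) ?f0 x = B.P T h x" unfolding h_def using T0 T0 x by (rule B.P_semigroup)
    also have "\<dots> \<le> (1 / 2 + ln (A.mean (\<lambda>y. exp (4 * H y)))) / 4"
    proof (rule step[OF _ x])
      fix x b assume x: "x \<in> \<Omega>" and b: "0 \<le> b" "b \<le> t1"
      have "B.P (b + (t1 + u)) h x \<le> B.P (b + (t1 + u)) (\<lambda>_. 2) x"
        using b pos x stage1 by (intro B.P_mono) (auto simp: h_def)
      then have "B.P b (B.P (t1 + u) h) x \<le> 2"
        using b pos x by (simp add: B.P_semigroup[of b "t1 + u"])
      then show "B.P b (B.P (t1 + u) h) x \<le> H x" using F(2)[OF x b] by (simp add: H_def)
    qed simp
    finally have main: "B.P (T + T) ?f0 x \<le> (1 / 2 + ln (A.mean (\<lambda>y. exp (4 * H y)))) / 4" .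
    have "A.mean (\<lambda>y. exp (4 * H y)) \<le> 1 + 1 / 2"
    proof -
      have exp8: "exp 8 \<le> (3 :: real) ^ 8"
      proof -
        have "exp 8 = (exp 1 :: real) ^ 8" by (simp flip: exp_of_nat_mult)
        also have "\<dots> \<le> 3 ^ 8" using e_less_272 by (intro power_mono) auto
        finally show ?thesis .
      qed
      have "exp (4 * H x) \<le> 1 + 4 * 3 ^ 8 * F x" if x: "x \<in> \<Omega>" for x
      proof -
        let ?z = "4 * H x"
        have z: "0 \<le> ?z" "?z \<le> 4 * F x" "?z \<le> 8"
          using F(1)[OF x] by (auto simp: H_def)
        have ez: "exp ?z \<le> 3 ^ 8" using z(3) exp8 by (smt (verit) exp_le_cancel_iff)
        have "exp ?z * (1 - ?z) \<le> exp ?z * exp (- ?z)"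
          using exp_ge_add_one_self[of "- ?z"] by (intro mult_left_mono) auto
        then have "exp ?z \<le> 1 + ?z * exp ?z" by (simp add: algebra_simps flip: exp_add)
        also have "\<dots> \<le> 1 + 4 * F x * 3 ^ 8"
          using z ez F(1)[OF x] by (intro add_left_mono mult_mono) auto
        finally show ?thesis by simp
      qed
      then have "A.mean (\<lambda>y. exp (4 * H y)) \<le> A.mean (\<lambda>x. 1 + 4 * 3 ^ 8 * F x)"
        by (rule A.mean_mono)
      also have "\<dots> = 1 + 4 * 3 ^ 8 * A.mean F"
        by (simp only: A.mean_add A.mean_cmult A.mean_const)
      also have "A.mean F \<le> M\<^sup>2 * B.mean F" using F(1) by (rule mean_le)
      also have "\<dots> \<le> M\<^sup>2 * (3 * e)"
      proof (rule mult_left_mono[OF power2_le_imp_le])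
        have "(B.mean F)\<^sup>2 \<le> B.ip (\<lambda>_. 1) (\<lambda>_. 1) * B.ip F F"
          unfolding B.mean_eq_ip by (rule B.cauchy_schwarz)
        also have "B.ip (\<lambda>_. 1) (\<lambda>_. 1) = 1" by (simp flip: B.mean_eq_ip)
        also have "B.ip F F \<le> 6 * e\<^sup>2"
          using order_trans[OF F(3) mult_left_mono[OF norm_h, of "3 * e\<^sup>2"]] by simp
        also have "1 * (6 * e\<^sup>2) \<le> (3 * e)\<^sup>2" by (simp add: power_mult_distrib)
        finally show "(B.mean F)\<^sup>2 \<le> (3 * e)\<^sup>2" by simp
      qed (use e0 in simp_all)
      finally have "A.mean (\<lambda>y. exp (4 * H y)) \<le> 1 + 4 * 3 ^ 8 * (M\<^sup>2 * (3 * e))" by simp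
      then show ?thesis using e by simp
    qed
    then have "ln (A.mean (\<lambda>y. exp (4 * H y))) \<le> 1 / 2"
      by (intro ln_le_half A.mean_exp_pos)
    then show ?thesis using main by simp
  qed

  have "B.ent (T + T) x \<le> 1 / 2" if x: "x \<in> \<Omega>" for x
  proof -
    have TT: "0 \<le> T + T" using T0 by simp
    let ?p = "B.rel_density (T + T) x"
    define f where "f = (\<lambda>y. ln (1 + ?p y))"
    have p: "0 \<le> ?p y" if "y \<in> \<Omega>" for y using B.density_nonneg TT x that by simp
    have "B.ent (T + T) x \<le> B.P (T + T) (\<lambda>y. 2 * (f y - ln 2)) x"
      unfolding B.ent_eq B.P_def
    proof (rule sum_mono)
      fix y assume y: "y \<in> \<Omega>"
      let ?w = "transition \<Omega> G' (T + T) x y"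
      show "?w * ln (?p y) \<le> ?w * (2 * (f y - ln 2))"
      proof (cases "?w = 0")
        case False
        then have py: "0 < ?p y" using p[OF y] B.transition_eq[OF y, of "T + T" x] by fastforce
        \<comment> \<open>From \<open>4 * p \<le> (1 + p)\<^sup>2\<close>. This replaces
          \<open>ln p\<close>, unbounded below, by the nonnegative \<open>f\<close>, for which
          \<open>exp f = 1 + p\<close> has mean 2.\<close>
        have "ln (?p y) \<le> ln (((1 + ?p y) / 2)\<^sup>2)"
          using py zero_le_power2[of "?p y - 1"]
          by (subst ln_le_cancel_iff) (auto simp: power2_eq_square field_simps)
        also have "\<dots> = 2 * (f y - ln 2)" using py by (simp add: f_def ln_realpow ln_div)
        finally show ?thesis using B.transition_nonneg[OF TT x y] by (rule mult_left_mono)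
      qed simp
    qed
    also have "\<dots> = 2 * (B.P (T + T) f x - ln 2)"
      unfolding B.P_cmult B.P_diff using TT x by simp
    also have "\<dots> \<le> 2 * (B.P (T + T) f x - B.mean f)"
    proof -
      \<comment> \<open>Jensen's inequality for \<open>ln\<close>: as \<open>1 + ?p y\<close> has
        mean 2, \<open>ln 2\<close> may be replaced by the mean of \<open>f\<close>.\<close>
      have "B.mean f \<le> B.mean (\<lambda>y. ln 2 + 1 / 2 * (?p y - 1))"
      proof (rule B.mean_mono)
        fix y assume y: "y \<in> \<Omega>"
        have "ln ((1 + ?p y) / 2) \<le> (1 + ?p y) / 2 - 1" using p[OF y] by (intro ln_le_minus_one) simp
        then show "f y \<le> ln 2 + 1 / 2 * (?p y - 1)"
          using p[OF y] by (simp add: f_def ln_div field_simps)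
      qed
      also have "\<dots> = ln 2"
        unfolding B.mean_add B.mean_cmult B.mean_diff using B.mean_density[OF TT x] by simp
      finally show ?thesis by simp
    qed
    also have "\<dots> = 2 * B.P (T + T) (\<lambda>y. f y - B.mean f) x"
      unfolding B.P_diff using TT x by simp
    also have "\<dots> \<le> 2 * (1 / 4)"
    proof (intro mult_left_mono bound x)
      show "0 \<le> f y" if "y \<in> \<Omega>" for y using p[OF that] by (simp add: f_def)
      have "B.mean (\<lambda>y. exp (f y)) = B.mean (\<lambda>y. 1 + ?p y)"
        unfolding B.mean_def f_def using p by (intro sum.cong refl) (simp add: add_pos_nonneg)
      also have "\<dots> = 2" using B.mean_density[OF TT x] by (simp add: B.mean_add)
      finally show "B.mean (\<lambda>y. exp (f y)) \<le> 2" by simp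
    qed simp
    finally show ?thesis by simp
  qed
  moreover have "T + T \<le> (6 + 40 * ent_factor) * M * ln m * t"
  proof -
    have "4 * (M * t) \<le> 6 * ln m * (M * t)" using lnm M t by (intro mult_right_mono) auto
    then show ?thesis by (simp add: T_def t1_def u_def K'_def algebra_simps)
  qed
  ultimately show ?thesis using T0 by (intro exI[of _ "T + T"]) auto
qed

end

section \<open>Mixing times\<close>

context rev_chain
begin

lemma l2_dist_continuous: "x \<in> \<Omega> \<Longrightarrow> continuous_on UNIV (\<lambda>t. l2_dist t x)"
proof -
  assume x: "x \<in> \<Omega>"
  have "continuous_on UNIV (\<lambda>t. transition \<Omega> G t x y)" if "y \<in> \<Omega>" for y
    using transition_deriv[OF x that] by (meson DERIV_isCont continuous_at_imp_continuous_on)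
  then show ?thesis
    unfolding l2_norm_def by (intro continuous_intros) (use \<pi>_pos in force)+
qed

lemma eventually_l2:
  assumes "poincare K" "x \<in> \<Omega>"
  obtains t where "0 \<le> t" "l2_dist t x \<le> 1 / 2"
proof -
  have "\<forall>\<^sub>F t in at_top. l2_dist t x < 1 / 2"
    by (rule order_tendstoD(2)[OF l2_dist_tendsto_0[OF assms]]) simp
  then have "\<forall>\<^sub>F t in at_top. 0 \<le> t \<and> l2_dist t x < 1 / 2"
    by (rule eventually_conj[OF eventually_ge_at_top[of 0]])
  then show thesis using that by (auto dest: eventually_happens)
qed

text \<open>By continuity the admissible times form a closed set, so the \<open>LEAST\<close> of the
  definition is an attained infimum; monotonicity covers later times.\<close>

lemma tau_2_eq:
  assumes K: "poincare K"
  shows "\<And>t x. x \<in> \<Omega> \<Longrightarrow> tau_2 \<Omega> G \<pi> \<le> t \<Longrightarrow> l2_dist t x \<le> 1 / 2"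
    and "0 \<le> tau_2 \<Omega> G \<pi>"
    and "\<And>t. 0 \<le> t \<Longrightarrow> (\<And>x. x \<in> \<Omega> \<Longrightarrow> l2_dist t x \<le> 1 / 2) \<Longrightarrow> tau_2 \<Omega> G \<pi> \<le> t"
proof -
  define \<tau> where "\<tau> = (\<lambda>x. LEAST t. 0 \<le> t \<and> l2_dist t x \<le> 1 / 2)"
  have tau: "tau_2 \<Omega> G \<pi> = Max (\<tau> ` \<Omega>)" by (simp add: tau_2_def \<tau>_def)
  have \<tau>: "0 \<le> \<tau> x \<and> l2_dist (\<tau> x) x \<le> 1 / 2 \<and> (\<forall>t\<ge>0. l2_dist t x \<le> 1 / 2 \<longrightarrow> \<tau> x \<le> t)"
    if x: "x \<in> \<Omega>" for x
  proof -
    let ?S = "{t. 0 \<le> t \<and> l2_dist t x \<le> 1 / 2}"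
    have "closed ?S"
      by (intro closed_Collect_conj closed_Collect_le continuous_intros l2_dist_continuous x)
    moreover have "?S \<noteq> {}" using eventually_l2[OF K x] by blast
    moreover have bdd: "bdd_below ?S" by (rule bdd_belowI[of _ 0]) simp
    ultimately have mem: "Inf ?S \<in> ?S" by (intro closed_contains_Inf)
    moreover have "Inf ?S \<le> t" if "t \<in> ?S" for t using that bdd by (rule cInf_lower)
    ultimately have "\<tau> x = Inf ?S" unfolding \<tau>_def by (intro Least_equality) auto
    then show ?thesis using mem cInf_lower[OF _ bdd] by auto
  qed
  have le: "\<tau> x \<le> tau_2 \<Omega> G \<pi>" if "x \<in> \<Omega>" for x unfolding tau using that by simp
  show "l2_dist t x \<le> 1 / 2" if "x \<in> \<Omega>" "tau_2 \<Omega> G \<pi> \<le> t" for t x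
    using l2_dist_antimono[of "\<tau> x" t x] \<tau>[OF that(1)] le[OF that(1)] that by simp
  show "0 \<le> tau_2 \<Omega> G \<pi>" using nonempty \<tau> le order_trans by blast
  show "tau_2 \<Omega> G \<pi> \<le> t" if "0 \<le> t" "\<And>x. x \<in> \<Omega> \<Longrightarrow> l2_dist t x \<le> 1 / 2" for t
    unfolding tau using \<tau> that nonempty by simp
qed

text \<open>The first bound is stated strictly beyond \<open>tau_Ent\<close>: an admissible time
  below \<open>t\<close> then exists, and monotonicity suffices without attainment of the
  infimum.\<close>

lemma tau_Ent_eq:
  assumes K: "poincare K"
  shows "\<And>t x. x \<in> \<Omega> \<Longrightarrow> tau_Ent \<Omega> G \<pi> < t \<Longrightarrow> ent t x \<le> 1 / 2"
    and "0 \<le> tau_Ent \<Omega> G \<pi>"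
    and "\<And>t. 0 \<le> t \<Longrightarrow> (\<And>x. x \<in> \<Omega> \<Longrightarrow> ent t x \<le> 1 / 2) \<Longrightarrow> tau_Ent \<Omega> G \<pi> \<le> t"
proof -
  define S where "S = (\<lambda>x. {t. 0 \<le> t \<and> ent t x \<le> 1 / 2})"
  have tau: "tau_Ent \<Omega> G \<pi> = Max ((\<lambda>x. Inf (S x)) ` \<Omega>)" by (simp add: tau_Ent_def S_def)
  have ne: "S x \<noteq> {}" if x: "x \<in> \<Omega>" for x
  proof -
    obtain t where t: "0 \<le> t" "l2_dist t x \<le> 1 / 2" using eventually_l2[OF K x] .
    moreover have "0 \<le> l2_dist t x" by (simp add: l2_dist_eq ip_self_nonneg)
    ultimately have "(l2_dist t x)\<^sup>2 \<le> (1 / 2)\<^sup>2" by (intro power_mono) auto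
    then have "ent t x \<le> 1 / 2" using ent_le_l2[OF t(1) x] by (simp add: power_divide)
    then show ?thesis using t(1) by (auto simp: S_def)
  qed
  have bdd: "bdd_below (S x)" for x by (rule bdd_belowI[of _ 0]) (simp add: S_def)
  have le: "Inf (S x) \<le> tau_Ent \<Omega> G \<pi>" if "x \<in> \<Omega>" for x unfolding tau using that by simp
  show "ent t x \<le> 1 / 2" if x: "x \<in> \<Omega>" and t: "tau_Ent \<Omega> G \<pi> < t" for t x
  proof -
    have "Inf (S x) < t" using le[OF x] t by simp
    then obtain s where "s \<in> S x" "s < t" using cInf_less_iff[OF ne[OF x] bdd] by blast
    then show ?thesis using ent_antimono[of s t x] x by (simp add: S_def)
  qed
  obtain x where x: "x \<in> \<Omega>" using nonempty by blast
  have "0 \<le> Inf (S x)" using ne[OF x] by (intro cInf_greatest) (auto simp: S_def)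
  then show "0 \<le> tau_Ent \<Omega> G \<pi>" using le[OF x] by simp
  show "tau_Ent \<Omega> G \<pi> \<le> t" if "0 \<le> t" "\<And>x. x \<in> \<Omega> \<Longrightarrow> ent t x \<le> 1 / 2" for t
    unfolding tau using that nonempty by (auto simp: S_def intro!: cInf_lower bdd)
qed

text \<open>The law from every starting state tends to \<open>\<pi>\<close>, while
  \<open>\<nu>\<close> does not move.\<close>

lemma stationary_unique:
  assumes K: "poincare K" and \<nu>: "stationary_distribution \<Omega> G \<nu>" and y: "y \<in> \<Omega>"
  shows "\<nu> y = \<pi> y"
proof -
  have lim: "((\<lambda>t. transition \<Omega> G t x y) \<longlongrightarrow> \<pi> y) at_top" if x: "x \<in> \<Omega>" for x
  proof (rule LIM_zero_cancel, rule Lim_null_comparison)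
    have "\<bar>transition \<Omega> G t x y - \<pi> y\<bar> \<le> l2_dist t x * sqrt (\<pi> y)" for t
    proof -
      let ?q = "transition \<Omega> G t x y - \<pi> y"
      have "\<pi> y * (?q / \<pi> y)\<^sup>2 \<le> (\<Sum>z\<in>\<Omega>. \<pi> z * ((transition \<Omega> G t x z - \<pi> z) / \<pi> z)\<^sup>2)"
        using y \<pi>_nonneg by (intro member_le_sum[of y \<Omega> "\<lambda>z. \<pi> z * ((transition \<Omega> G t x z - \<pi> z) / \<pi> z)\<^sup>2"]) auto
      then have "?q\<^sup>2 / \<pi> y * \<pi> y \<le> (l2_dist t x)\<^sup>2 * \<pi> y"
        using \<pi>_pos[OF y] unfolding l2_norm_def
        by (intro mult_right_mono) (auto simp: power2_eq_square sum_nonneg \<pi>_nonneg)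
      then have "?q\<^sup>2 \<le> (l2_dist t x)\<^sup>2 * \<pi> y" using \<pi>_pos[OF y] by simp
      from real_sqrt_le_mono[OF this] show ?thesis
        by (simp add: real_sqrt_mult l2_dist_eq ip_self_nonneg)
    qed
    then show "\<forall>\<^sub>F t in at_top. norm (transition \<Omega> G t x y - \<pi> y) \<le> l2_dist t x * sqrt (\<pi> y)" by simp
    show "((\<lambda>t. l2_dist t x * sqrt (\<pi> y)) \<longlongrightarrow> 0) at_top"
      using l2_dist_tendsto_0[OF K x] by (auto intro: tendsto_eq_intros)
  qed
  have "((\<lambda>t. \<Sum>x\<in>\<Omega>. \<nu> x * transition \<Omega> G t x y) \<longlongrightarrow> (\<Sum>x\<in>\<Omega>. \<nu> x * \<pi> y)) at_top"
    by (intro tendsto_intros lim)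
  also have "(\<Sum>x\<in>\<Omega>. \<nu> x * \<pi> y) = \<pi> y"
    using \<nu> by (simp add: stationary_distribution_def flip: sum_distrib_right)
  finally have lim_sum: "((\<lambda>t. \<Sum>x\<in>\<Omega>. \<nu> x * transition \<Omega> G t x y) \<longlongrightarrow> \<pi> y) at_top" .
  have "\<forall>\<^sub>F t in at_top. (\<Sum>x\<in>\<Omega>. \<nu> x * transition \<Omega> G t x y) = \<nu> y"
    using \<nu> y by (intro eventually_mono[OF eventually_ge_at_top[of 0]])
      (simp add: stationary_distribution_def)
  then have "((\<lambda>t::real. \<nu> y) \<longlongrightarrow> \<pi> y) at_top" by (rule Lim_transform_eventually[OF lim_sum])
  then show ?thesis by (simp add: tendsto_const_iff)
qed

end

text \<open>Some state has positive weight, and detailed balance carries positivity along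
  edges.\<close>

lemma irreducible_reversible_pos:
  assumes gen: "generator \<Omega> G" and irr: "irreducible_chain \<Omega> G" and rev: "reversible_chain \<Omega> G \<pi>"
    and \<pi>: "\<And>x. x \<in> \<Omega> \<Longrightarrow> 0 \<le> \<pi> x" "(\<Sum>x\<in>\<Omega>. \<pi> x) = 1" and y: "y \<in> \<Omega>"
  shows "0 < \<pi> y"
proof -
  have "\<exists>x\<in>\<Omega>. \<pi> x \<noteq> 0"
  proof (rule ccontr)
    assume "\<not> ?thesis"
    then have "(\<Sum>x\<in>\<Omega>. \<pi> x) = 0" by (intro sum.neutral) auto
    then show False using \<pi>(2) by simp
  qed
  then obtain x where x: "x \<in> \<Omega>" "0 < \<pi> x" using \<pi>(1) by (auto simp: less_le)
  have "(x, y) \<in> {(u, v). u \<in> \<Omega> \<and> v \<in> \<Omega> \<and> 0 < G u v}\<^sup>*"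
    using irr x y by (auto simp: irreducible_chain_def)
  then show ?thesis
  proof (induction rule: rtrancl_induct)
    case base
    show ?case by (rule x)
  next
    case (step u v)
    then have uv: "u \<in> \<Omega>" "v \<in> \<Omega>" "0 < \<pi> u * G u v" by auto
    then have "0 < \<pi> v * G v u" using rev by (simp add: reversible_chain_def)
    then show ?case using \<pi>(1)[OF uv(2)] by (cases "\<pi> v = 0") auto
  qed
qed

section \<open>Rescaled chains and the two-sided bounds\<close>

lemma irreducible_scaled:
  assumes "irreducible_chain \<Omega> G" "\<And>x. x \<in> \<Omega> \<Longrightarrow> 0 < r x"
    and "\<And>x y. x \<in> \<Omega> \<Longrightarrow> y \<in> \<Omega> \<Longrightarrow> G' x y = r x * G x y"
  shows "irreducible_chain \<Omega> G'"
proof -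
  have "0 < G' u v \<longleftrightarrow> 0 < G u v" if "u \<in> \<Omega>" "v \<in> \<Omega>" for u v
    using assms(2)[OF that(1)] assms(3)[OF that] by (simp add: zero_less_mult_iff)
  then have "{(u, v). u \<in> \<Omega> \<and> v \<in> \<Omega> \<and> 0 < G' u v} = {(u, v). u \<in> \<Omega> \<and> v \<in> \<Omega> \<and> 0 < G u v}"
    by blast
  then show ?thesis using assms(1) by (simp add: irreducible_chain_def)
qed

lemma generator_scaled:
  assumes "generator \<Omega> G" "\<And>x. x \<in> \<Omega> \<Longrightarrow> 0 < r x"
    and "\<And>x y. x \<in> \<Omega> \<Longrightarrow> y \<in> \<Omega> \<Longrightarrow> G' x y = r x * G x y"
  shows "generator \<Omega> G'"
  unfolding generator_def
proof (intro conjI ballI impI)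
  fix x assume x: "x \<in> \<Omega>"
  have "(\<Sum>y\<in>\<Omega>. G' x y) = (\<Sum>y\<in>\<Omega>. r x * G x y)" by (intro sum.cong refl assms(3) x)
  then show "(\<Sum>y\<in>\<Omega>. G' x y) = 0"
    using generatorD(4)[OF assms(1) x] by (simp flip: sum_distrib_left)
  fix y assume y: "y \<in> \<Omega>" "x \<noteq> y"
  show "0 \<le> G' x y"
    using assms(2)[OF x] generatorD(3)[OF assms(1) x y] by (simp add: assms(3)[OF x y(1)])
qed (use generatorD[OF assms(1)] in auto)

text \<open>Large enough for both 11 in \<open>l2_step\<close> and
  \<open>6 + 40 * ent_factor\<close> in \<open>ent_step\<close>.\<close>

definition mixing_const :: real where
  "mixing_const = 11 + 40 * ent_factor"

context time_change
begin

lemma tau_2_le: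
  assumes "irreducible_chain \<Omega> G"
  shows "tau_2 \<Omega> G' \<pi>' \<le> (mixing_const * M * ln (max 2 M)) * tau_2 \<Omega> G \<pi>"
proof -
  obtain K where K: "A.poincare K" using A.irreducible_imp_poincare[OF assms] by blast
  let ?C = "mixing_const * M * ln (max 2 M)"
  have C: "0 < ?C" using M ent_factor_pos by (simp add: mixing_const_def add_pos_pos)
  \<comment> \<open>Arguing with all \<open>t\<close> above the mixing time ensures
    \<open>0 < t\<close>, as \<open>l2_step\<close> requires; for a single state the mixing time is
    0.\<close>
  have "tau_2 \<Omega> G' \<pi>' / ?C \<le> tau_2 \<Omega> G \<pi>"
  proof (rule dense_ge)
    fix t assume t: "tau_2 \<Omega> G \<pi> < t"
    then have t0: "0 < t" using A.tau_2_eq(2)[OF K] by simp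
    have "A.l2_dist t x \<le> 1 / 2" if "x \<in> \<Omega>" for x using A.tau_2_eq(1)[OF K that] t by simp
    from l2_step[OF t0 this] obtain T where T: "0 \<le> T" "T \<le> 11 * M * ln (max 2 M) * t"
      "\<And>x. x \<in> \<Omega> \<Longrightarrow> B.l2_dist T x \<le> 1 / 2" by blast
    have "tau_2 \<Omega> G' \<pi>' \<le> T" by (rule B.tau_2_eq(3)[OF poincare_transfer[OF K] T(1,3)])
    also have "T \<le> 11 * (M * ln (max 2 M) * t)" using T(2) by (simp add: mult.assoc)
    also have "\<dots> \<le> mixing_const * (M * ln (max 2 M) * t)"
      using M t0 ent_factor_pos by (intro mult_right_mono) (auto simp: mixing_const_def)
    finally show "tau_2 \<Omega> G' \<pi>' / ?C \<le> t" using C by (simp add: pos_divide_le_eq mult_ac)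
  qed
  then show ?thesis using C by (simp add: pos_divide_le_eq mult_ac)
qed

lemma tau_Ent_le:
  assumes "irreducible_chain \<Omega> G"
  shows "tau_Ent \<Omega> G' \<pi>' \<le> (mixing_const * M * ln (max 2 M)) * tau_Ent \<Omega> G \<pi>"
proof -
  obtain K where K: "A.poincare K" using A.irreducible_imp_poincare[OF assms] by blast
  let ?C = "mixing_const * M * ln (max 2 M)"
  have C: "0 < ?C" using M ent_factor_pos by (simp add: mixing_const_def add_pos_pos)
  have "tau_Ent \<Omega> G' \<pi>' / ?C \<le> tau_Ent \<Omega> G \<pi>"
  proof (rule dense_ge)
    fix t assume t: "tau_Ent \<Omega> G \<pi> < t"
    then have t0: "0 < t" using A.tau_Ent_eq(2)[OF K] by simp
    have "A.ent t x \<le> 1 / 2" if "x \<in> \<Omega>" for x using A.tau_Ent_eq(1)[OF K that] t by simp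
    from ent_step[OF t0 this] obtain T where T: "0 \<le> T"
      "T \<le> (6 + 40 * ent_factor) * M * ln (max 2 M) * t"
      "\<And>x. x \<in> \<Omega> \<Longrightarrow> B.ent T x \<le> 1 / 2" by blast
    have "tau_Ent \<Omega> G' \<pi>' \<le> T" by (rule B.tau_Ent_eq(3)[OF poincare_transfer[OF K] T(1,3)])
    also have "T \<le> (6 + 40 * ent_factor) * (M * ln (max 2 M) * t)" using T(2) by (simp add: mult.assoc)
    also have "\<dots> \<le> mixing_const * (M * ln (max 2 M) * t)"
      using M t0 by (intro mult_right_mono) (auto simp: mixing_const_def)
    finally show "tau_Ent \<Omega> G' \<pi>' / ?C \<le> t" using C by (simp add: pos_divide_le_eq mult_ac)
  qed
  then show ?thesis using C by (simp add: pos_divide_le_eq mult_ac)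
qed

end

text \<open>The normalized weights \<open>\<pi> x / r x\<close> are reversible for
  \<open>G'\<close>, hence equal to \<open>\<pi>'\<close> by uniqueness.\<close>

lemma time_change_of_stationary:
  fixes M :: real
  assumes M: "1 \<le> M" and gen: "generator \<Omega> G" and irr: "irreducible_chain \<Omega> G"
    and st: "stationary_distribution \<Omega> G \<pi>" and rev: "reversible_chain \<Omega> G \<pi>"
    and r: "\<forall>x\<in>\<Omega>. r x \<in> {1 / M <..< M}"
    and G': "\<forall>x\<in>\<Omega>. \<forall>y\<in>\<Omega>. G' x y = r x * G x y"
    and st': "stationary_distribution \<Omega> G' \<pi>'"
  obtains c where "time_change \<Omega> G \<pi> G' \<pi>' r M c"
proof -
  have r_pos: "0 < r x" if "x \<in> \<Omega>" for x
  proof -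
    have "0 < 1 / M" using M by simp
    then show ?thesis using r that by (meson greaterThanLessThan_iff less_trans)
  qed
  have \<pi>: "0 \<le> \<pi> x" if "x \<in> \<Omega>" for x using st that by (simp add: stationary_distribution_def)
  have \<pi>_sum: "(\<Sum>x\<in>\<Omega>. \<pi> x) = 1" using st by (simp add: stationary_distribution_def)
  have \<pi>_pos: "0 < \<pi> x" if "x \<in> \<Omega>" for x
    using irreducible_reversible_pos[OF gen irr rev \<pi> \<pi>_sum that] .
  have gen': "generator \<Omega> G'" and irr': "irreducible_chain \<Omega> G'"
    using generator_scaled[of \<Omega> G r G'] irreducible_scaled[of \<Omega> G r G'] gen irr r_pos G' by simp_all
  define Z where "Z = (\<Sum>x\<in>\<Omega>. \<pi> x / r x)"
  have Z: "0 < Z"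
    unfolding Z_def using generatorD(1,2)[OF gen] \<pi>_pos r_pos by (intro sum_pos) auto
  define \<nu> where "\<nu> = (\<lambda>x. \<pi> x / r x / Z)"
  have \<nu>_pos: "0 < \<nu> x" if "x \<in> \<Omega>" for x using that \<pi>_pos r_pos Z by (simp add: \<nu>_def)
  have \<nu>_sum: "(\<Sum>x\<in>\<Omega>. \<nu> x) = 1"
    unfolding \<nu>_def sum_divide_distrib[symmetric] Z_def[symmetric] using Z by simp
  have \<nu>_rev: "reversible_chain \<Omega> G' \<nu>"
    unfolding reversible_chain_def
  proof (intro ballI)
    fix x y assume xy: "x \<in> \<Omega>" "y \<in> \<Omega>"
    have "\<nu> x * G' x y = \<pi> x * G x y / Z" "\<nu> y * G' y x = \<pi> y * G y x / Z"
      using xy G' r_pos[OF xy(1)] r_pos[OF xy(2)] by (simp_all add: \<nu>_def)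
    then show "\<nu> x * G' x y = \<nu> y * G' y x" using rev xy by (simp add: reversible_chain_def)
  qed
  interpret N: rev_chain \<Omega> G' \<nu>
    by unfold_locales (use gen' \<nu>_pos \<nu>_sum \<nu>_rev in auto)
  have eq: "\<pi>' x = \<nu> x" if "x \<in> \<Omega>" for x
    using N.irreducible_imp_poincare[OF irr'] N.stationary_unique[OF _ st' that] by blast
  show thesis
  proof (rule that)
    show "time_change \<Omega> G \<pi> G' \<pi>' r M (1 / Z)"
    proof unfold_locales
      show "reversible_chain \<Omega> G' \<pi>'" using \<nu>_rev eq by (simp add: reversible_chain_def)
      show "(\<Sum>x\<in>\<Omega>. \<pi>' x) = 1" using \<nu>_sum eq by simp
      show "\<pi>' x * r x = 1 / Z * \<pi> x" if "x \<in> \<Omega>" for x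
        using eq[OF that] r_pos[OF that] by (simp add: \<nu>_def)
    qed (use M gen gen' rev r G' \<pi>_pos \<pi>_sum \<nu>_pos eq in auto)
  qed
qed

text \<open>The interval from \<open>1 / M\<close> to \<open>M\<close> is invariant under inversion,
  so each one-sided bound also holds with the chains exchanged.\<close>

lemma (in time_change) time_change_inverse:
  "time_change \<Omega> G' \<pi>' G \<pi> (\<lambda>x. 1 / r x) M (1 / c)"
proof unfold_locales
  fix x assume x: "x \<in> \<Omega>"
  show "1 / M < 1 / r x \<and> 1 / r x < M"
    using r[OF x] r_pos[OF x] M by (auto simp: field_simps)
  show "\<pi> x * (1 / r x) = 1 / c * \<pi>' x"
    using \<pi>'[OF x] r_pos[OF x] c_bounds by (simp add: field_simps)
  fix y assume "y \<in> \<Omega>"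
  then show "G x y = 1 / r x * G' x y" using G'[OF x] r_pos[OF x] by simp
qed (use M in auto)

theorem corollary2p1:
  "\<exists>C>0. \<forall>(M::real) (\<Omega>::nat set) (G::nat \<Rightarrow> nat \<Rightarrow> real) (r::nat \<Rightarrow> real)
      (\<pi>::nat \<Rightarrow> real) (G'::nat \<Rightarrow> nat \<Rightarrow> real) (\<pi>'::nat \<Rightarrow> real).
     M \<ge> 1 \<longrightarrow>
     generator \<Omega> G \<longrightarrow>
     irreducible_chain \<Omega> G \<longrightarrow>
     stationary_distribution \<Omega> G \<pi> \<longrightarrow>
     reversible_chain \<Omega> G \<pi> \<longrightarrow>
     (\<forall>x\<in>\<Omega>. r x \<in> {1 / M <..< M}) \<longrightarrow>
     (\<forall>x\<in>\<Omega>. \<forall>y\<in>\<Omega>. G' x y = r x * G x y) \<longrightarrow>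
     stationary_distribution \<Omega> G' \<pi>' \<longrightarrow>
       tau_2 \<Omega> G' \<pi>' / (C * M * ln (max 2 M)) \<le> tau_2 \<Omega> G \<pi> \<and>
       tau_2 \<Omega> G \<pi> \<le> (C * M * ln (max 2 M)) * tau_2 \<Omega> G' \<pi>' \<and>
       tau_Ent \<Omega> G' \<pi>' / (C * M * ln (max 2 M)) \<le> tau_Ent \<Omega> G \<pi> \<and>
       tau_Ent \<Omega> G \<pi> \<le> (C * M * ln (max 2 M)) * tau_Ent \<Omega> G' \<pi>'"
proof (intro exI[of _ mixing_const] conjI[of "0 < mixing_const"] allI impI)
  show const: "0 < mixing_const" using ent_factor_pos by (simp add: mixing_const_def)
  fix M :: real and \<Omega> :: "nat set" and G G' :: "nat \<Rightarrow> nat \<Rightarrow> real" and r \<pi> \<pi>' :: "nat \<Rightarrow> real"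
  assume hyps: "1 \<le> M" "generator \<Omega> G" "irreducible_chain \<Omega> G" "stationary_distribution \<Omega> G \<pi>"
    "reversible_chain \<Omega> G \<pi>" "\<forall>x\<in>\<Omega>. r x \<in> {1 / M <..< M}"
    "\<forall>x\<in>\<Omega>. \<forall>y\<in>\<Omega>. G' x y = r x * G x y" "stationary_distribution \<Omega> G' \<pi>'"
  then obtain c where "time_change \<Omega> G \<pi> G' \<pi>' r M c" by (rule time_change_of_stationary)
  then interpret time_change \<Omega> G \<pi> G' \<pi>' r M c .
  interpret inv: time_change \<Omega> G' \<pi>' G \<pi> "\<lambda>x. 1 / r x" M "1 / c" by (rule time_change_inverse)
  have irr': "irreducible_chain \<Omega> G'" by (rule irreducible_scaled[OF hyps(3) r_pos G'])
  have C: "0 < mixing_const * M * ln (max 2 M)" using const hyps(1) by simp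
  show "tau_2 \<Omega> G' \<pi>' / (mixing_const * M * ln (max 2 M)) \<le> tau_2 \<Omega> G \<pi> \<and>
       tau_2 \<Omega> G \<pi> \<le> (mixing_const * M * ln (max 2 M)) * tau_2 \<Omega> G' \<pi>' \<and>
       tau_Ent \<Omega> G' \<pi>' / (mixing_const * M * ln (max 2 M)) \<le> tau_Ent \<Omega> G \<pi> \<and>
       tau_Ent \<Omega> G \<pi> \<le> (mixing_const * M * ln (max 2 M)) * tau_Ent \<Omega> G' \<pi>'"
    using tau_2_le[OF hyps(3)] inv.tau_2_le[OF irr'] tau_Ent_le[OF hyps(3)] inv.tau_Ent_le[OF irr'] C
    by (simp add: pos_divide_le_eq mult.commute)
qed

end
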